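(* Let $K$ be a field and let $H=(H^0,H^1,s,r)$ be a hypergraph such that $|s(h)|\geq 2$ and $|r(h)|\geq 2$ for any $h\in H^1$. Then the map $$\nu:L_K(H)\to\mathbb N_0\cup\{-\infty\},\qquad a\mapsto\max\{|p|\mid p\in\operatorname{supp}(a)\}$$ is a local valuation on $(L_K(H),H^0)$. Here the convention $\max(\emptyset)=-\infty$ is used.
   Context: Algebras are associative but not necessarily unital. A multiset over a set $Y$ is a function $M:Y\to\mathbb N_0$; its support is $M_{\mathrm{supp}}=\{y\in Y\mid M(y)>0\}$. $\mathrm{Mult}(Y)$ is the set of multisets over $Y$ with finite, nonempty support, and $|M|=\sum_{y\in M_{\mathrm{supp}}}M(y)$. A (directed) hypergraph is a quadruple $H=(H^0,H^1,s,r)$ where $H^0,H^1$ are sets and $s,r:H^1\to\mathrm{Mult}(H^0)$ are maps. All hypergraphs are assumed nonempty (not $H^0=H^1=\emptyset$). For each $h\in H^1$ fix listings with multiplicity $s(h)=\{s(h)_1,\dots,s(h)_{|s(h)|}\}$ and $r(h)=\{r(h)_1,\dots,r(h)_{|r(h)|}\}$. Let $X:=\{v,h_{ij},h_{ij}^*\mid v\in H^0,h\in H^1,1\le i\le|s(h)|,1\le j\le|r(h)|\}$ and let $K\langle X\rangle$ be the free (nonunital) $K$-algebra on $X$. The Leavitt path algebra $L_K(H)$ is the quotient of $K\langle X\rangle$ by the ideal generated by the relations: (i) $uv=\delta_{uv}u$ ($u,v\in H^0$); (ii) $s(h)_ih_{ij}=h_{ij}=h_{ij}r(h)_j$ and $r(h)_jh_{ij}^*=h_{ij}^*=h_{ij}^*s(h)_i$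 for all $h,i,j$; (iii) $\sum_{k=1}^{|r(h)|}h_{ik}h_{jk}^*=\delta_{ij}s(h)_i$ ($h\in H^1$, $1\le i,j\le|s(h)|$); (iv) $\sum_{k=1}^{|s(h)|}h_{ki}^*h_{kj}=\delta_{ij}r(h)_i$ ($h\in H^1$, $1\le i,j\le|r(h)|$). Let $\hat E$ be the directed graph with vertex set $H^0$ and edges all $h_{ij}$ (with source $s(h)_i$ and range $r(h)_j$) and all $h_{ij}^*$ (with source $r(h)_j$ and range $s(h)_i$). A d-path is a word over $X$ which is either a single vertex (length $0$), or a nonempty word $x_1\dots x_n$ of edges of $\hat E$ such that the range of $x_i$ equals the source of $x_{i+1}$ for $1\le i\le n-1$ (length $n$). The length of $p$ is denoted $|p|$. The words $h_{i1}h_{j1}^*$ ($h\in H^1$, $1\le i,j\le|s(h)|$) and $h_{1i}^*h_{1j}$ ($h\in H^1$, $1\le i,j\le|r(h)|$) are called forbidden. A nod-path is a d-path none of whose (contiguous) subwords is forbidden. The nod-paths form a $K$-basis of $L_K(H)$: every $a\in L_K(H)$ has exactly one representative $\mathrm{NF}(a)\in K\langle X\rangle$ that is a linear combination of nod-paths. $\operatorname{supp}(a)$ is the set of all nod-paths appearing in $\mathrm{NF}(a)$ with nonzero coefficient. A ring with enough idempotents is a pair $(R,E)$ where $R$ is a ring and $E$ is a set of nonzero orthogonal idempotents in $R$ for which the set of finite sums of distinct elements of $E$ is a set of local units for $R$ (for every finite $S\subseteq R$ there is such a sum $x$ with $xsx=s$ for all $s\in S$). $(L_K(H),H^0)$ is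 a ring with enough idempotents. A local valuation on $(R,E)$ is a map $\nu:R\to\mathbb N_0\cup\{-\infty\}$ such that (i) $\nu(x)=-\infty\Leftrightarrow x=0$; (ii) $\nu(x-y)\le\max\{\nu(x),\nu(y)\}$ for all $x,y\in R$; (iii) $\nu(xy)=\nu(x)+\nu(y)$ for any $e\in E$, $x\in Re$ and $y\in eR$. Conventions: $-\infty<n$ for $n\in\mathbb N_0$, and $(-\infty)+n=n+(-\infty)=-\infty$ for $n\in\mathbb N_0\cup\{-\infty\}$. *)

theory Defs
  imports
    "HOL-Library.Extended"
    "HOL-Library.FuncSet"
    "HOL-Library.Multiset"
    "HOL-Library.Poly_Mapping"
    "HOL-Library.Sublist"
    "HOL-Algebra.QuotRing"
begin

section \<open>Hypergraphs\<close>

text \<open>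
  A multiset of the library always has finite support, so only nonemptiness of the support has to
  be demanded.
\<close>

definition Mult :: "'v set \<Rightarrow> 'v multiset set"
  where "Mult Y = {M. set_mset M \<noteq> {} \<and> set_mset M \<subseteq> Y}"

record ('v, 'h) hypergraph =
  verts :: "'v set"
  hedges :: "'h set"
  src :: "'h \<Rightarrow> 'v multiset"
  rng :: "'h \<Rightarrow> 'v multiset"

locale hypergraph =
  fixes H :: "('v, 'h) hypergraph"
  assumes src_closed: "src H \<in> hedges H \<rightarrow> Mult (verts H)"
    and rng_closed: "rng H \<in> hedges H \<rightarrow> Mult (verts H)"
    and nonempty: "\<not> (verts H = {} \<and> hedges H = {})"

text \<open>
  A listing orders the source and range multisets as lists. List positions start at \<open>0\<close>, so
  \<open>S h ! i\<close> is the mathematician's $s(h)_{i+1}$; the indices of all generators below are shifted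
  in the same way.
\<close>

definition listing :: "('v, 'h) hypergraph \<Rightarrow> ('h \<Rightarrow> 'v list) \<Rightarrow> ('h \<Rightarrow> 'v list) \<Rightarrow> bool"
  where "listing H S R \<longleftrightarrow> (\<forall>h\<in>hedges H. mset (S h) = src H h \<and> mset (R h) = rng H h)"


section \<open>Free nonunital algebras\<close>

text \<open>
  Words are wrapped lists, made a monoid under concatenation (written additively, as the library's
  convolution product on \<^typ>\<open>'a \<Rightarrow>\<^sub>0 'b\<close> requires). Hence \<open>'x word \<Rightarrow>\<^sub>0 'k\<close> is the free unital
  algebra on \<open>'x\<close>, and the free nonunital algebra on a set \<open>X\<close> consists of its elements supported
  on nonempty words over \<open>X\<close>.
\<close>

datatype 'x word = Word (letters: "'x list")

instantiation word :: (type) monoid_add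
begin

definition zero_word :: "'a word"
  where "0 = Word []"

definition plus_word :: "'a word \<Rightarrow> 'a word \<Rightarrow> 'a word"
  where "u + w = Word (letters u @ letters w)"

instance
  by standard (simp_all add: zero_word_def plus_word_def)

end

definition mono_word :: "'x list \<Rightarrow> 'x word \<Rightarrow>\<^sub>0 'k::field"
  where "mono_word xs = Poly_Mapping.single (Word xs) 1"

definition smult :: "'k::field \<Rightarrow> ('x word \<Rightarrow>\<^sub>0 'k) \<Rightarrow> 'x word \<Rightarrow>\<^sub>0 'k"
  where "smult c f = Poly_Mapping.map ((*) c) f"

text \<open>
  The records of \<^theory>\<open>HOL-Algebra.Ring\<close> have a field for a unit. The rings considered here need
  not have one, so that field is unspecified and unused.
\<close>

definition free_algebra :: "'x set \<Rightarrow> ('x word \<Rightarrow>\<^sub>0 'k::field) ring"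
  where "free_algebra X =
    \<lparr>carrier = {f. Poly_Mapping.keys f \<subseteq> Word ` {xs. xs \<noteq> [] \<and> set xs \<subseteq> X}},
     mult = (*), one = undefined, zero = 0, add = (+)\<rparr>"

definition algebra_ideal :: "'x set \<Rightarrow> ('x word \<Rightarrow>\<^sub>0 'k::field) set \<Rightarrow> bool"
  where "algebra_ideal X I \<longleftrightarrow>
    I \<subseteq> carrier (free_algebra X) \<and> 0 \<in> I \<and>
    (\<forall>f\<in>I. \<forall>g\<in>I. f + g \<in> I) \<and>
    (\<forall>c. \<forall>f\<in>I. smult c f \<in> I) \<and>
    (\<forall>a\<in>carrier (free_algebra X). \<forall>f\<in>I. a * f \<in> I \<and> f * a \<in> I)"

definition generated_ideal ::
    "'x set \<Rightarrow> ('x word \<Rightarrow>\<^sub>0 'k::field) set \<Rightarrow> ('x word \<Rightarrow>\<^sub>0 'k) set"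
  where "generated_ideal X G = \<Inter> {I. algebra_ideal X I \<and> G \<subseteq> I}"


section \<open>Leavitt path algebras\<close>

text \<open>\<open>Edge h i j\<close> and \<open>Ghost h i j\<close> stand for $h_{ij}$ and $h_{ij}^*$.\<close>

datatype ('v, 'h) gen = Vertex 'v | Edge 'h nat nat | Ghost 'h nat nat

definition edge_gens :: "('v, 'h) hypergraph \<Rightarrow> ('v, 'h) gen set"
  where "edge_gens H =
    {Edge h i j |h i j. h \<in> hedges H \<and> i < size (src H h) \<and> j < size (rng H h)} \<union>
    {Ghost h i j |h i j. h \<in> hedges H \<and> i < size (src H h) \<and> j < size (rng H h)}"

definition gens :: "('v, 'h) hypergraph \<Rightarrow> ('v, 'h) gen set"
  where "gens H = Vertex ` verts H \<union> edge_gens H"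

definition relations_i ::
    "('v, 'h) hypergraph \<Rightarrow> (('v, 'h) gen word \<Rightarrow>\<^sub>0 'k::field) set"
  where "relations_i H =
    {mono_word [Vertex u, Vertex v] - (if u = v then mono_word [Vertex u] else 0)
      |u v. u \<in> verts H \<and> v \<in> verts H}"

definition relations_ii ::
    "('v, 'h) hypergraph \<Rightarrow> ('h \<Rightarrow> 'v list) \<Rightarrow> ('h \<Rightarrow> 'v list) \<Rightarrow>
      (('v, 'h) gen word \<Rightarrow>\<^sub>0 'k::field) set"
  where "relations_ii H S R =
    (\<Union>h\<in>hedges H. \<Union>i\<in>{..<size (src H h)}. \<Union>j\<in>{..<size (rng H h)}.
      {mono_word [Vertex (S h ! i), Edge h i j] - mono_word [Edge h i j],
       mono_word [Edge h i j, Vertex (R h ! j)] - mono_word [Edge h i j],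
       mono_word [Vertex (R h ! j), Ghost h i j] - mono_word [Ghost h i j],
       mono_word [Ghost h i j, Vertex (S h ! i)] - mono_word [Ghost h i j]})"

definition relations_iii ::
    "('v, 'h) hypergraph \<Rightarrow> ('h \<Rightarrow> 'v list) \<Rightarrow> (('v, 'h) gen word \<Rightarrow>\<^sub>0 'k::field) set"
  where "relations_iii H S =
    {(\<Sum>k<size (rng H h). mono_word [Edge h i k, Ghost h j k]) -
        (if i = j then mono_word [Vertex (S h ! i)] else 0)
      |h i j. h \<in> hedges H \<and> i < size (src H h) \<and> j < size (src H h)}"

definition relations_iv ::
    "('v, 'h) hypergraph \<Rightarrow> ('h \<Rightarrow> 'v list) \<Rightarrow> (('v, 'h) gen word \<Rightarrow>\<^sub>0 'k::field) set"
  where "relations_iv H R =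
    {(\<Sum>k<size (src H h). mono_word [Ghost h k i, Edge h k j]) -
        (if i = j then mono_word [Vertex (R h ! i)] else 0)
      |h i j. h \<in> hedges H \<and> i < size (rng H h) \<and> j < size (rng H h)}"

definition leavitt_ideal ::
    "('v, 'h) hypergraph \<Rightarrow> ('h \<Rightarrow> 'v list) \<Rightarrow> ('h \<Rightarrow> 'v list) \<Rightarrow>
      (('v, 'h) gen word \<Rightarrow>\<^sub>0 'k::field) set"
  where "leavitt_ideal H S R =
    generated_ideal (gens H)
      (relations_i H \<union> relations_ii H S R \<union> relations_iii H S \<union> relations_iv H R)"

text \<open>Elements of the Leavitt path algebra are cosets, that is, sets of elements of the free algebra.\<close>

definition leavitt_path_algebra ::
    "('v, 'h) hypergraph \<Rightarrow> ('h \<Rightarrow> 'v list) \<Rightarrow> ('h \<Rightarrow> 'v list) \<Rightarrow>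
      (('v, 'h) gen word \<Rightarrow>\<^sub>0 'k::field) set ring"
  where "leavitt_path_algebra H S R = free_algebra (gens H) Quot leavitt_ideal H S R"

definition vertex_elements ::
    "('v, 'h) hypergraph \<Rightarrow> ('h \<Rightarrow> 'v list) \<Rightarrow> ('h \<Rightarrow> 'v list) \<Rightarrow>
      (('v, 'h) gen word \<Rightarrow>\<^sub>0 'k::field) set set"
  where "vertex_elements H S R =
    (\<lambda>v. leavitt_ideal H S R +>\<^bsub>free_algebra (gens H)\<^esub> mono_word [Vertex v]) ` verts H"


section \<open>Normal forms\<close>

text \<open>
  Source and range in the directed graph $\hat E$ attached to the hypergraph; only the equations for
  \<open>Edge\<close> and \<open>Ghost\<close> matter.
\<close>

fun gen_source :: "('h \<Rightarrow> 'v list) \<Rightarrow> ('h \<Rightarrow> 'v list) \<Rightarrow> ('v, 'h) gen \<Rightarrow> 'v"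
  where
    "gen_source S R (Vertex v) = v"
  | "gen_source S R (Edge h i j) = S h ! i"
  | "gen_source S R (Ghost h i j) = R h ! j"

fun gen_range :: "('h \<Rightarrow> 'v list) \<Rightarrow> ('h \<Rightarrow> 'v list) \<Rightarrow> ('v, 'h) gen \<Rightarrow> 'v"
  where
    "gen_range S R (Vertex v) = v"
  | "gen_range S R (Edge h i j) = R h ! j"
  | "gen_range S R (Ghost h i j) = S h ! i"

definition d_path ::
    "('v, 'h) hypergraph \<Rightarrow> ('h \<Rightarrow> 'v list) \<Rightarrow> ('h \<Rightarrow> 'v list) \<Rightarrow> ('v, 'h) gen list \<Rightarrow> bool"
  where "d_path H S R p \<longleftrightarrow>
    (\<exists>v\<in>verts H. p = [Vertex v]) \<or>
    (p \<noteq> [] \<and> set p \<subseteq> edge_gens H \<and>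
      successively (\<lambda>x y. gen_range S R x = gen_source S R y) p)"

definition path_length :: "('v, 'h) gen list \<Rightarrow> nat"
  where "path_length p = (if \<exists>v. p = [Vertex v] then 0 else length p)"

definition forbidden :: "('v, 'h) hypergraph \<Rightarrow> ('v, 'h) gen list set"
  where "forbidden H =
    {[Edge h i 0, Ghost h j 0]
      |h i j. h \<in> hedges H \<and> i < size (src H h) \<and> j < size (src H h)} \<union>
    {[Ghost h 0 i, Edge h 0 j]
      |h i j. h \<in> hedges H \<and> i < size (rng H h) \<and> j < size (rng H h)}"

definition nod_path ::
    "('v, 'h) hypergraph \<Rightarrow> ('h \<Rightarrow> 'v list) \<Rightarrow> ('h \<Rightarrow> 'v list) \<Rightarrow> ('v, 'h) gen list \<Rightarrow> bool"
  where "nod_path H S R p \<longleftrightarrow> d_path H S R p \<and> (\<forall>q\<in>forbidden H. \<not> sublist q p)"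

text \<open>The representatives of an element of the Leavitt path algebra are the members of the coset.\<close>

definition NF ::
    "('v, 'h) hypergraph \<Rightarrow> ('h \<Rightarrow> 'v list) \<Rightarrow> ('h \<Rightarrow> 'v list) \<Rightarrow>
      (('v, 'h) gen word \<Rightarrow>\<^sub>0 'k::field) set \<Rightarrow> ('v, 'h) gen word \<Rightarrow>\<^sub>0 'k"
  where "NF H S R a = (THE f. f \<in> a \<and> Poly_Mapping.keys f \<subseteq> Word ` {p. nod_path H S R p})"

definition supp ::
    "('v, 'h) hypergraph \<Rightarrow> ('h \<Rightarrow> 'v list) \<Rightarrow> ('h \<Rightarrow> 'v list) \<Rightarrow>
      (('v, 'h) gen word \<Rightarrow>\<^sub>0 'k::field) set \<Rightarrow> ('v, 'h) gen list set"
  where "supp H S R a = {p. Word p \<in> Poly_Mapping.keys (NF H S R a)}"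

definition path_valuation ::
    "('v, 'h) hypergraph \<Rightarrow> ('h \<Rightarrow> 'v list) \<Rightarrow> ('h \<Rightarrow> 'v list) \<Rightarrow>
      (('v, 'h) gen word \<Rightarrow>\<^sub>0 'k::field) set \<Rightarrow> nat extended"
  where "path_valuation H S R a =
    (if supp H S R a = {} then Minf else Fin (Max (path_length ` supp H S R a)))"


section \<open>Local valuations\<close>

locale nonunital_ring = abelian_group R for R (structure) +
  assumes mult_closed: "\<lbrakk>x \<in> carrier R; y \<in> carrier R\<rbrakk> \<Longrightarrow> x \<otimes> y \<in> carrier R"
    and mult_assoc: "\<lbrakk>x \<in> carrier R; y \<in> carrier R; z \<in> carrier R\<rbrakk> \<Longrightarrow>
      (x \<otimes> y) \<otimes> z = x \<otimes> (y \<otimes> z)"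
    and distrib_right: "\<lbrakk>x \<in> carrier R; y \<in> carrier R; z \<in> carrier R\<rbrakk> \<Longrightarrow>
      (x \<oplus> y) \<otimes> z = x \<otimes> z \<oplus> y \<otimes> z"
    and distrib_left: "\<lbrakk>x \<in> carrier R; y \<in> carrier R; z \<in> carrier R\<rbrakk> \<Longrightarrow>
      z \<otimes> (x \<oplus> y) = z \<otimes> x \<oplus> z \<otimes> y"

locale ring_with_enough_idempotents = nonunital_ring R for R (structure) +
  fixes E :: "'a set"
  assumes E_subset: "E \<subseteq> carrier R"
    and E_nonzero: "e \<in> E \<Longrightarrow> e \<noteq> \<zero>"
    and E_idem: "e \<in> E \<Longrightarrow> e \<otimes> e = e"
    and E_orthogonal: "\<lbrakk>e \<in> E; f \<in> E; e \<noteq> f\<rbrakk> \<Longrightarrow> e \<otimes> f = \<zero>"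
    and local_units: "\<lbrakk>finite T; T \<subseteq> carrier R\<rbrakk> \<Longrightarrow>
      \<exists>F. finite F \<and> F \<subseteq> E \<and>
        (\<forall>t\<in>T. finsum R (\<lambda>e. e) F \<otimes> t \<otimes> finsum R (\<lambda>e. e) F = t)"

text \<open>
  The values lie in $\mathbb{N}_0 \cup \{-\infty\}$, that is, in \<^typ>\<open>nat extended\<close> without
  \<^term>\<open>Pinf :: nat extended\<close>. On this subset the order and the addition of the library are the
  conventional ones.
\<close>

locale local_valuation = ring_with_enough_idempotents R E for R (structure) and E +
  fixes \<nu> :: "'a \<Rightarrow> nat extended"
  assumes val_range: "\<nu> \<in> carrier R \<rightarrow> insert Minf (range Fin)"
    and val_eq_Minf_iff: "x \<in> carrier R \<Longrightarrow> \<nu> x = Minf \<longleftrightarrow> x = \<zero>"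
    and val_diff: "\<lbrakk>x \<in> carrier R; y \<in> carrier R\<rbrakk> \<Longrightarrow> \<nu> (x \<ominus> y) \<le> max (\<nu> x) (\<nu> y)"
    and val_mult: "\<lbrakk>e \<in> E; x \<in> (\<lambda>a. a \<otimes> e) ` carrier R; y \<in> (\<lambda>a. e \<otimes> a) ` carrier R\<rbrakk> \<Longrightarrow>
      \<nu> (x \<otimes> y) = \<nu> x + \<nu> y"

end

theory Submission
  imports Defs Complex_Main
begin

text \<open>
  The generators act from the left on the span of the empty word and the nod-paths, by
  concatenation followed by one rewriting step at the front. All relations act as zero, so applying
  an element of the free algebra to the empty word gives a normal form that depends only on its
  coset. For the degree, let \<open>f\<close> and \<open>g\<close> be composable normal forms with nod-paths \<open>p\<close>, \<open>q\<close> of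
  maximal length, and let \<open>p\<close> end in $h_{ik}$ and \<open>q\<close> begin with $h_{jl}^*$ (or dually). If $P_k$ and
  $Q_l$ are the coefficients obtained by varying $k$ and $l$, then the top coefficients of the product
  are $P_k Q_l$ for $k \neq l$ and $P_k Q_k - P_1 Q_1$ for $k \neq 1$, and these do not all vanish when
  there are at least two indices.
\<close>

section \<open>Linear maps on free algebras\<close>

text \<open>What needs an argument is the uniqueness of normal forms. A confluence proof would
  compare the two ways of rewriting a word in which forbidden words of types (iii) and (iv) overlap;
  with an action, this comparison becomes the single identity \<open>lact_sum_relation\<close>. One
  rewriting step at the front is enough because the outer index of the first edge does not influence
  whether a word is irreducible, so the words replacing a forbidden one create no new forbidden
  subword. The degree cannot be read off one pair of longest paths: distinct pairs may produce the
  same word of maximal length, and their contributions may cancel. Such collisions change only the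
  two indices that meet at the cut, hence all other letters are kept fixed. The term $P_1 Q_1$ is
  subtracted for every $k > 1$ because rewriting $h_{i1} h_{j1}^*$ spreads its coefficient over all
  these $k$. With a single index there would be nothing to spread over and the length would drop;
  this is what the hypothesis on $|s(h)|$ and $|r(h)|$ excludes.\<close>

lemma lookup_smult [simp]: "Poly_Mapping.lookup (smult c f) w = c * Poly_Mapping.lookup f w"
  by (simp add: smult_def map.rep_eq when_def)

interpretation pm: module "smult :: 'k::field \<Rightarrow> ('x word \<Rightarrow>\<^sub>0 'k) \<Rightarrow> 'x word \<Rightarrow>\<^sub>0 'k"
  by standard (auto intro!: poly_mapping_eqI simp: lookup_add algebra_simps)

lemma smult_eq_single_times: "smult c f = Poly_Mapping.single 0 c * f"
  by (simp add: smult_def mult_map_scale_conv_mult)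

lemma keys_smult: "Poly_Mapping.keys (smult c f) \<subseteq> Poly_Mapping.keys f"
  by (auto simp: in_keys_iff)

lemma mono_word_append: "mono_word (xs @ ys) = mono_word xs * mono_word ys"
  by (simp add: mono_word_def mult_single plus_word_def)

lemma mono_word_Nil: "mono_word [] = 1"
  by (simp add: mono_word_def zero_word_def flip: single_one)

lemma keys_mono_word [simp]: "Poly_Mapping.keys (mono_word xs) = {Word xs}"
  by (simp add: mono_word_def)

lemma mono_word_neq_0 [simp]: "mono_word xs \<noteq> 0"
  using keys_mono_word[of xs] by (metis insert_not_empty keys_zero)

lemma mono_word_eq_iff [simp]: "mono_word xs = mono_word ys \<longleftrightarrow> xs = ys"
  using keys_mono_word by (metis singleton_inject word.inject)

lemma lookup_mono_word: "Poly_Mapping.lookup (mono_word xs) w = of_bool (w = Word xs)"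
  by (auto simp: mono_word_def lookup_single when_def)

lemma smult_single: "smult c (Poly_Mapping.single w d) = Poly_Mapping.single w (c * d)"
  by (simp add: smult_def)

lemma smult_times_left: "smult c f * g = smult c (f * g)"
  by (simp add: smult_eq_single_times mult.assoc)

lemma poly_eq_sum_mono:
  "(f :: 'x word \<Rightarrow>\<^sub>0 'k::field) = (\<Sum>w\<in>Poly_Mapping.keys f. smult (Poly_Mapping.lookup f w) (mono_word (letters w)))"
proof (rule poly_mapping_eqI)
  fix v
  have "(\<Sum>w\<in>Poly_Mapping.keys f. Poly_Mapping.lookup f w * of_bool (v = w)) =
      Poly_Mapping.lookup f v"
    by (cases "v \<in> Poly_Mapping.keys f")
      (simp_all add: of_bool_def if_distrib[of "(*) _"] sum.delta' in_keys_iff cong: if_cong)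
  then show "Poly_Mapping.lookup f v = Poly_Mapping.lookup
      (\<Sum>w\<in>Poly_Mapping.keys f. smult (Poly_Mapping.lookup f w) (mono_word (letters w))) v"
    by (simp add: lookup_sum lookup_mono_word)
qed

abbreviation linear_poly ::
    "(('x word \<Rightarrow>\<^sub>0 'k) \<Rightarrow> ('y word \<Rightarrow>\<^sub>0 'k::field)) \<Rightarrow> bool"
  where "linear_poly \<equiv> module_hom smult smult"

lemma linear_polyI:
  assumes "\<And>f g. F (f + g) = F f + F g" "\<And>c f. F (smult c f) = smult c (F f)"
  shows "linear_poly F"
  using assms by unfold_locales auto

lemma linear_poly_expand:
  assumes "linear_poly F"
  shows "F f =
    (\<Sum>w\<in>Poly_Mapping.keys f. smult (Poly_Mapping.lookup f w) (F (mono_word (letters w))))"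
proof -
  interpret F: module_hom smult smult F by fact
  have "F f = F (\<Sum>w\<in>Poly_Mapping.keys f. smult (Poly_Mapping.lookup f w) (mono_word (letters w)))"
    by (rule arg_cong[OF poly_eq_sum_mono])
  then show ?thesis
    by (simp add: F.sum F.scale)
qed

text \<open>The comparison is made at the words of the given \<open>f\<close> only, so whatever is
  known about the support of \<open>f\<close> is available at each of them.\<close>

lemma linear_poly_eqI:
  assumes "linear_poly F" "linear_poly G"
    and "\<And>w. w \<in> Poly_Mapping.keys f \<Longrightarrow> F (mono_word (letters w)) = G (mono_word (letters w))"
  shows "F f = G f"
  unfolding linear_poly_expand[OF assms(1), of f] linear_poly_expand[OF assms(2), of f]
  using assms(3) by simp

lemma linear_poly_in_subspace:
  assumes "linear_poly F" "pm.subspace U"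
    and "\<And>w. w \<in> Poly_Mapping.keys f \<Longrightarrow> F (mono_word (letters w)) \<in> U"
  shows "F f \<in> U"
  unfolding linear_poly_expand[OF assms(1), of f]
  using assms(2,3) by (intro pm.subspace_sum pm.subspace_scale)

lemma linear_poly_times_right: "linear_poly (\<lambda>f. f * g)"
  by (rule linear_polyI) (simp_all add: distrib_right smult_times_left)

text \<open>A scalar acts as left multiplication by a constant polynomial. Constants are central, as
  can be checked on monomials: the coefficients commute, and the empty word is neutral on both
  sides.\<close>

lemma smult_times_right: "f * smult c g = smult c (f * g)"
proof -
  have "f * Poly_Mapping.single 0 c = smult c f"
    by (rule linear_poly_eqI[OF linear_poly_times_right pm.module_hom_scale_self])
      (unfold mono_word_def mult_single smult_single, simp)
  then have "f * Poly_Mapping.single 0 c * g = smult c f * g"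
    by (rule arg_cong)
  then show ?thesis
    by (simp only: mult.assoc smult_eq_single_times)
qed

lemma linear_poly_times_left: "linear_poly ((*) g)"
  by (rule linear_polyI) (simp_all add: distrib_left smult_times_right)

lemma linear_poly_comp: "linear_poly F \<Longrightarrow> linear_poly G \<Longrightarrow> linear_poly (\<lambda>f. F (G f))"
  using module_hom_compose[of smult smult G smult F] by (simp add: o_def)

lemma linear_poly_diff:
  assumes "linear_poly F" "linear_poly G"
  shows "linear_poly (\<lambda>f. F f - G f)"
  by (rule linear_polyI) (simp_all add: module_hom.add[OF assms(1)] module_hom.add[OF assms(2)]
      module_hom.scale[OF assms(1)] module_hom.scale[OF assms(2)] pm.scale_right_diff_distrib)

section \<open>Linear extension of maps given on words\<close>

definition linext ::
    "('x list \<Rightarrow> 'y word \<Rightarrow>\<^sub>0 'k::field) \<Rightarrow> ('x word \<Rightarrow>\<^sub>0 'k) \<Rightarrow> 'y word \<Rightarrow>\<^sub>0 'k"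
  where "linext \<phi> f =
    (\<Sum>w\<in>Poly_Mapping.keys f. smult (Poly_Mapping.lookup f w) (\<phi> (letters w)))"

text \<open>Supports may shrink under sums and scalar multiples, so the sums in
  \<open>linext\<close> are compared over a common finite set of words.\<close>

lemma linext_superset:
  assumes "finite B" "Poly_Mapping.keys f \<subseteq> B"
  shows "linext \<phi> f = (\<Sum>w\<in>B. smult (Poly_Mapping.lookup f w) (\<phi> (letters w)))"
  unfolding linext_def using assms by (intro sum.mono_neutral_left) (auto simp: in_keys_iff)

lemma linear_linext:
  fixes \<phi> :: "'x list \<Rightarrow> 'y word \<Rightarrow>\<^sub>0 'k::field"
  shows "linear_poly (linext \<phi>)"
proof (rule linear_polyI)
  fix f g :: "'x word \<Rightarrow>\<^sub>0 'k"
  let ?B = "Poly_Mapping.keys f \<union> Poly_Mapping.keys g"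
  show "linext \<phi> (f + g) = linext \<phi> f + linext \<phi> g"
    using keys_add[of f g]
    by (subst (1 2 3) linext_superset[of ?B])
      (auto simp: lookup_add pm.scale_left_distrib sum.distrib)
  show "linext \<phi> (smult c f) = smult c (linext \<phi> f)" for c
    using keys_smult[of c f]
    by (subst (1 2) linext_superset[of "Poly_Mapping.keys f"]) (auto simp: pm.scale_sum_right)
qed

lemma linext_mono_word [simp]: "linext \<phi> (mono_word xs) = \<phi> xs"
  by (simp add: linext_def lookup_mono_word)

lemma linext_add: "linext \<phi> (f + g) = linext \<phi> f + linext \<phi> g"
  and linext_diff: "linext \<phi> (f - g) = linext \<phi> f - linext \<phi> g"
  and linext_smult: "linext \<phi> (smult c f) = smult c (linext \<phi> f)"
  and linext_zero [simp]: "linext \<phi> 0 = 0"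
  and linext_sum: "linext \<phi> (sum F A) = (\<Sum>a\<in>A. linext \<phi> (F a))"
  by (rule module_hom.add module_hom.diff module_hom.scale module_hom.zero module_hom.sum,
    rule linear_linext)+

section \<open>Subspaces spanned by sets of words\<close>

definition keys_in :: "'x list set \<Rightarrow> ('x word \<Rightarrow>\<^sub>0 'k::field) set"
  where "keys_in P = {f. \<forall>w\<in>Poly_Mapping.keys f. letters w \<in> P}"

lemma subspace_keys_in: "pm.subspace (keys_in P :: ('x word \<Rightarrow>\<^sub>0 'k::field) set)"
proof (rule pm.subspaceI)
  show "0 \<in> keys_in P"
    by (simp add: keys_in_def)
  show "f + g \<in> keys_in P" if "f \<in> keys_in P" "g \<in> keys_in P" for f g :: "'x word \<Rightarrow>\<^sub>0 'k"
    unfolding keys_in_def using that keys_add[of f g] by (auto simp: keys_in_def)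
  show "smult c f \<in> keys_in P" if "f \<in> keys_in P" for c and f :: "'x word \<Rightarrow>\<^sub>0 'k"
    using that keys_smult[of c f] by (auto simp: keys_in_def)
qed

lemma zero_in_keys_in [simp]: "0 \<in> keys_in P"
  by (simp add: keys_in_def)

lemma mono_word_in_keys_in [simp]: "mono_word xs \<in> keys_in P \<longleftrightarrow> xs \<in> P"
  by (simp add: keys_in_def)

lemma keys_in_mono: "f \<in> keys_in P \<Longrightarrow> P \<subseteq> Q \<Longrightarrow> f \<in> keys_in Q"
  by (auto simp: keys_in_def)

lemma linext_in_subspace:
  assumes "pm.subspace U" "f \<in> keys_in P" "\<And>xs. xs \<in> P \<Longrightarrow> \<phi> xs \<in> U"
  shows "linext \<phi> f \<in> U"
  by (rule linear_poly_in_subspace[OF linear_linext assms(1)])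
    (use assms(2,3) in \<open>simp add: keys_in_def\<close>)

lemma times_in_keys_in:
  assumes "f \<in> keys_in P" "g \<in> keys_in Q" "\<And>xs ys. xs \<in> P \<Longrightarrow> ys \<in> Q \<Longrightarrow> xs @ ys \<in> U"
  shows "f * g \<in> keys_in U"
  unfolding keys_in_def
proof (clarify)
  fix w
  assume "w \<in> Poly_Mapping.keys (f * g)"
  then obtain u v where "u \<in> Poly_Mapping.keys f" "v \<in> Poly_Mapping.keys g" "w = u + v"
    using keys_mult[of f g] by blast
  then show "letters w \<in> U"
    using assms by (simp add: keys_in_def plus_word_def)
qed

text \<open>Serves to read off the coefficient of a given word in a sum of distinct words, at most
  one of which matches.\<close>

lemma sum_of_bool_unique:
  assumes "finite T" "\<And>k l. P k \<Longrightarrow> P l \<Longrightarrow> k = l"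
  shows "(\<Sum>k\<in>T. of_bool (P k)) = (of_bool (\<exists>k\<in>T. P k) :: 'a::semiring_1)"
proof (cases "\<exists>k\<in>T. P k")
  case True
  then obtain k where k: "k \<in> T" "P k"
    by blast
  then have "P l \<longleftrightarrow> l = k" for l
    using assms(2) by blast
  then show ?thesis
    using assms(1) k(1) by (simp add: of_bool_def)
qed simp

section \<open>The nonunital free algebra and its ideals\<close>

lemma keys_subset_Word_iff: "Poly_Mapping.keys f \<subseteq> Word ` P \<longleftrightarrow> f \<in> keys_in P"
  unfolding keys_in_def by (force simp: image_iff subset_iff intro: word.expand)

lemma carrier_free_algebra:
  "carrier (free_algebra X) = keys_in {xs. xs \<noteq> [] \<and> set xs \<subseteq> X}"
  by (simp add: free_algebra_def keys_subset_Word_iff)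

lemma carrier_times:
  assumes "f \<in> carrier (free_algebra X)" "g \<in> carrier (free_algebra X)"
  shows "f * g \<in> carrier (free_algebra X)"
  unfolding carrier_free_algebra
  by (rule times_in_keys_in[OF assms[unfolded carrier_free_algebra]]) auto

text \<open>Makes the family intersected in \<open>generated_ideal\<close> nonempty, which keeps the
  generated ideal inside the free algebra.\<close>

lemma algebra_ideal_carrier: "algebra_ideal X (carrier (free_algebra X))"
  using carrier_times unfolding algebra_ideal_def carrier_free_algebra
  by (auto intro: pm.subspace_add pm.subspace_scale subspace_keys_in)

lemma algebra_ideal_subspace: "algebra_ideal X I \<Longrightarrow> pm.subspace I"
  by (auto simp: algebra_ideal_def intro: pm.subspaceI)

lemma algebra_ideal_generated:
  assumes "G \<subseteq> carrier (free_algebra X)"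
  shows "algebra_ideal X (generated_ideal X G)"
proof -
  have "generated_ideal X G \<subseteq> carrier (free_algebra X)"
    using assms algebra_ideal_carrier by (auto simp: generated_ideal_def)
  then show ?thesis
    by (auto simp: algebra_ideal_def generated_ideal_def)
qed

lemma generated_ideal_superset: "G \<subseteq> generated_ideal X G"
  by (auto simp: generated_ideal_def)

lemma generated_ideal_minimal: "algebra_ideal X I \<Longrightarrow> G \<subseteq> I \<Longrightarrow> generated_ideal X G \<subseteq> I"
  by (auto simp: generated_ideal_def)

section \<open>The action on irreducible words\<close>

text \<open>
  The word \<open>ed b h i j\<close> is $h_{ij}$ or $h_{ji}^*$; this notation turns relations (iii) and (iv)
  into one another by negating \<open>b\<close>.
\<close>

fun ed :: "bool \<Rightarrow> 'h \<Rightarrow> nat \<Rightarrow> nat \<Rightarrow> ('v, 'h) gen"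
  where "ed True h i j = Edge h i j" | "ed False h i j = Ghost h j i"

lemma ed_eq_iff [simp]:
  "ed b h i j = ed b' h' i' j' \<longleftrightarrow> b = b' \<and> h = h' \<and> i = i' \<and> j = j'"
  by (cases b; cases b') auto

lemma ed_neq_Vertex [simp]: "ed b h i j \<noteq> Vertex v" "Vertex v \<noteq> ed b h i j"
  by (cases b; simp)+

lemma gen_cases [case_names Vertex ed]:
  obtains v where "x = Vertex v" | b h i j where "x = ed b h i j"
  by (cases x) (metis ed.simps)+

text \<open>Forbidden words have length two, so containing one as a sublist is a statement about
  neighbouring letters; this links it to \<open>successively\<close>.\<close>

lemma successively_iff_append:
  "successively P p \<longleftrightarrow> (\<forall>u x y v. p = u @ x # y # v \<longrightarrow> P x y)"
proof (induction p rule: induct_list012)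
  case (3 x y zs)
  have "(\<forall>u a b v. x # y # zs = u @ a # b # v \<longrightarrow> P a b) \<longleftrightarrow>
      P x y \<and> (\<forall>u a b v. y # zs = u @ a # b # v \<longrightarrow> P a b)"
    by (subst Cons_eq_append_conv) blast
  then show ?case
    using 3 by simp
qed (simp_all add: Cons_eq_append_conv)

section \<open>Edges in both orientations\<close>

locale leavitt_setting = hypergraph H for H :: "('v, 'h) hypergraph" +
  fixes S R :: "'h \<Rightarrow> 'v list"
  assumes listing: "listing H S R"
begin

abbreviation "source \<equiv> gen_source S R"
abbreviation "range_of \<equiv> gen_range S R"

text \<open>The first index of \<open>ed b h i j\<close> runs over the positions of
  \<open>ends b h\<close>, the second over those of \<open>ends (\<not> b) h\<close>.\<close>

definition ends :: "bool \<Rightarrow> 'h \<Rightarrow> 'v list"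
  where "ends b = (if b then S else R)"

lemma source_ed [simp]: "source (ed b h i j) = ends b h ! i"
  and range_of_ed [simp]: "range_of (ed b h i j) = ends (\<not> b) h ! j"
  by (cases b; simp add: ends_def)+

lemma size_src: "h \<in> hedges H \<Longrightarrow> size (src H h) = length (ends True h)"
  and size_rng: "h \<in> hedges H \<Longrightarrow> size (rng H h) = length (ends False h)"
  using listing by (auto simp: listing_def ends_def) (metis size_mset)+

lemma
  assumes "h \<in> hedges H"
  shows ends_pos: "0 < length (ends b h)"
    and ends_in_verts: "i < length (ends b h) \<Longrightarrow> ends b h ! i \<in> verts H"
proof -
  have "mset (ends b h) \<in> Mult (verts H)"
    using assms listing src_closed rng_closed by (auto simp: listing_def ends_def)
  then have "set (ends b h) \<noteq> {}" "set (ends b h) \<subseteq> verts H"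
    by (auto simp: Mult_def)
  then show "0 < length (ends b h)" "i < length (ends b h) \<Longrightarrow> ends b h ! i \<in> verts H"
    by auto
qed

lemma ed_in_edge_gens:
  "ed b h i j \<in> edge_gens H \<longleftrightarrow>
    h \<in> hedges H \<and> i < length (ends b h) \<and> j < length (ends (\<not> b) h)"
  by (cases b) (auto simp: edge_gens_def size_src size_rng)

lemma edge_gensE:
  assumes "x \<in> edge_gens H"
  obtains b h i j where "x = ed b h i j" "h \<in> hedges H" "i < length (ends b h)"
    "j < length (ends (\<not> b) h)"
  using assms ed_in_edge_gens by (cases x rule: gen_cases) (auto simp: edge_gens_def)

lemma Vertex_notin_edge_gens [simp]: "Vertex v \<notin> edge_gens H"
  by (simp add: edge_gens_def)

lemma forbidden_eq:
  "forbidden H = {[ed b h i 0, ed (\<not> b) h 0 j] | b h i j.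
    h \<in> hedges H \<and> i < length (ends b h) \<and> j < length (ends b h)}" (is "?l = ?r")
proof
  show "?l \<subseteq> ?r"
    unfolding forbidden_def
  proof (intro Un_least subsetI)
    fix p :: "('v, 'h) gen list"
    assume "p \<in> {[Edge h i 0, Ghost h j 0] |h i j.
      h \<in> hedges H \<and> i < size (src H h) \<and> j < size (src H h)}"
    then obtain h i j where "p = [ed True h i 0, ed (\<not> True) h 0 j]" "h \<in> hedges H"
      "i < length (ends True h)" "j < length (ends True h)"
      by (auto simp: size_src)
    then show "p \<in> ?r"
      by blast
  next
    fix p :: "('v, 'h) gen list"
    assume "p \<in> {[Ghost h 0 i, Edge h 0 j] |h i j.
      h \<in> hedges H \<and> i < size (rng H h) \<and> j < size (rng H h)}"
    then obtain h i j where "p = [ed False h i 0, ed (\<not> False) h 0 j]" "h \<in> hedges H"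
      "i < length (ends False h)" "j < length (ends False h)"
      by (auto simp: size_rng)
    then show "p \<in> ?r"
      by blast
  qed
  have "[ed b h i 0, ed (\<not> b) h 0 j] \<in> ?l"
    if "h \<in> hedges H" "i < length (ends b h)" "j < length (ends b h)" for b h i j
    using that by (cases b) (auto simp: forbidden_def size_src size_rng)
  then show "?r \<subseteq> ?l"
    by blast
qed

section \<open>Irreducible words\<close>

definition joins :: "('v, 'h) gen \<Rightarrow> ('v, 'h) gen \<Rightarrow> bool"
  where "joins x y \<longleftrightarrow> range_of x = source y \<and> [x, y] \<notin> forbidden H"

text \<open>The second disjunct also admits the empty word, the extra basis vector of the module.
  The other irreducible words are the nod-paths, by \<open>nod_path_iff\<close>.\<close>

definition irred :: "('v, 'h) gen list \<Rightarrow> bool"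
  where "irred w \<longleftrightarrow>
    (\<exists>v\<in>verts H. w = [Vertex v]) \<or> set w \<subseteq> edge_gens H \<and> successively joins w"

lemma irred_Nil [simp]: "irred []"
  by (simp add: irred_def)

lemma irred_Vertex_Cons [simp]: "irred (Vertex v # z) \<longleftrightarrow> v \<in> verts H \<and> z = []"
  by (auto simp: irred_def)

lemma irred_Cons_edge:
  assumes "x \<in> edge_gens H"
  shows "irred (x # z) \<longleftrightarrow> z = [] \<or> irred z \<and> hd z \<in> edge_gens H \<and> joins x (hd z)"
  using assms by (cases z) (auto simp: irred_def)

lemma irred_ed_Cons:
  "irred (ed b h i j # z) \<longleftrightarrow> ed b h i j \<in> edge_gens H \<and>
    (z = [] \<or> irred z \<and> hd z \<in> edge_gens H \<and> joins (ed b h i j) (hd z))"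
  by (cases "ed b h i j \<in> edge_gens H") (auto simp: irred_Cons_edge, auto simp: irred_def)

lemma irred_edges: "set w \<subseteq> edge_gens H \<Longrightarrow> irred w \<longleftrightarrow> successively joins w"
  by (auto simp: irred_def)

lemma irred_append:
  assumes "set p \<subseteq> edge_gens H" "set q \<subseteq> edge_gens H"
  shows "irred (p @ q) \<longleftrightarrow>
    irred p \<and> irred q \<and> (p \<noteq> [] \<longrightarrow> q \<noteq> [] \<longrightarrow> joins (last p) (hd q))"
  using assms by (auto simp: irred_edges successively_append_iff)

lemma forbidden_Cons2: "q \<in> forbidden H \<Longrightarrow> \<exists>x y. q = [x, y]"
  by (auto simp: forbidden_eq)

lemma nod_path_iff: "nod_path H S R p \<longleftrightarrow> irred p \<and> p \<noteq> []"
proof -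
  have sublist_iff: "(\<exists>q\<in>forbidden H. sublist q p) \<longleftrightarrow> (\<exists>u x y v. [x, y] \<in> forbidden H \<and> p = u @ x # y # v)"
    (is "?l \<longleftrightarrow> ?r")
  proof
    assume ?l
    then obtain q u v where q: "q \<in> forbidden H" "p = u @ q @ v"
      by (auto simp: sublist_def)
    obtain x y where "q = [x, y]"
      using forbidden_Cons2[OF q(1)] by blast
    with q have "[x, y] \<in> forbidden H" "p = u @ x # y # v"
      by simp_all
    then show ?r
      by blast
  next
    assume ?r
    then obtain u x y v where "[x, y] \<in> forbidden H" "p = u @ [x, y] @ v"
      by auto
    then show ?l
      by (metis sublist_appendI)
  qed
  have "successively (\<lambda>x y. range_of x = source y) p \<and> (\<forall>q\<in>forbidden H. \<not> sublist q p) \<longleftrightarrow>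
      successively joins p"
    using sublist_iff unfolding joins_def successively_iff_append by blast
  moreover have "\<not> sublist q [Vertex v]" if "q \<in> forbidden H" for q v
    using forbidden_Cons2[OF that] by (auto dest: sublist_length_le)
  ultimately show ?thesis
    unfolding nod_path_def d_path_def irred_def by auto
qed

section \<open>The action of a generator on an irreducible word\<close>

definition vact :: "'v \<Rightarrow> ('v, 'h) gen list \<Rightarrow> ('v, 'h) gen word \<Rightarrow>\<^sub>0 'k::field"
  where "vact v w = (case w of [] \<Rightarrow> mono_word [Vertex v]
    | y # _ \<Rightarrow> if source y = v then mono_word w else 0)"

text \<open>Relation (iii) or (iv), solved for the summand with inner index \<open>0\<close> and
  multiplied by \<open>w\<close> on the right; the vertex is absorbed by
  \<open>vact\<close>.\<close>

definition reduct ::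
    "bool \<Rightarrow> 'h \<Rightarrow> nat \<Rightarrow> nat \<Rightarrow> ('v, 'h) gen list \<Rightarrow> ('v, 'h) gen word \<Rightarrow>\<^sub>0 'k::field"
  where "reduct b h i j w = (if i = j then vact (ends b h ! i) w else 0) -
    (\<Sum>k\<in>{1..<length (ends (\<not> b) h)}. mono_word (ed b h i k # ed (\<not> b) h k j # w))"

text \<open>
  \<open>lact x w\<close> is the normal form of \<open>x # w\<close>, for a generator \<open>x\<close> and an irreducible word \<open>w\<close>. The
  empty word is included so that the action has a cyclic vector.
\<close>

definition lact ::
    "('v, 'h) gen \<Rightarrow> ('v, 'h) gen list \<Rightarrow> ('v, 'h) gen word \<Rightarrow>\<^sub>0 'k::field"
  where "lact x w = (case x of Vertex v \<Rightarrow> vact v w | _ \<Rightarrow>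
    (case w of [] \<Rightarrow> mono_word [x] | y # z \<Rightarrow>
      if range_of x \<noteq> source y then 0
      else if [x, y] \<notin> forbidden H then mono_word (case y of Vertex _ \<Rightarrow> [x] | _ \<Rightarrow> x # w)
      else case (x, y) of
        (Edge h i _, Ghost _ j _) \<Rightarrow> reduct True h i j z
      | (Ghost h _ i, Edge _ _ j) \<Rightarrow> reduct False h i j z
      | _ \<Rightarrow> 0))"

lemma lact_Vertex [simp]: "lact (Vertex v) = vact v"
  by (rule ext) (simp add: lact_def)

lemma lact_ed_Nil [simp]: "lact (ed b h i j) [] = mono_word [ed b h i j]"
  by (cases b) (simp_all add: lact_def)

lemma Vertex_notin_forbidden [simp]: "[x, Vertex v] \<notin> forbidden H"
  by (auto simp: forbidden_eq)

lemma lact_ed_Vertex: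
  "lact (ed b h i j) (Vertex v # z) = (if ends (\<not> b) h ! j = v then mono_word [ed b h i j] else 0)"
  using Vertex_notin_forbidden[of "ed b h i j" v] by (cases b) (simp_all add: lact_def ends_def)

lemma lact_ed_neq:
  "ends (\<not> b) h ! j \<noteq> source y \<Longrightarrow> lact (ed b h i j) (y # z) = 0"
  by (cases b) (simp_all add: lact_def ends_def)

lemma lact_ed_joins:
  assumes "joins (ed b h i j) (ed b' h' i' j')"
  shows "lact (ed b h i j) (ed b' h' i' j' # z) = mono_word (ed b h i j # ed b' h' i' j' # z)"
  using assms by (cases b; cases b') (simp_all add: lact_def joins_def)

lemma lact_forbidden:
  assumes "h \<in> hedges H" "i < length (ends b h)" "j < length (ends b h)"
  shows "lact (ed b h i 0) (ed (\<not> b) h 0 j # z) = reduct b h i j z"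
proof -
  have "[ed b h i 0, ed (\<not> b) h 0 j] \<in> forbidden H"
    using assms by (auto simp: forbidden_eq)
  then show ?thesis
    by (cases b) (simp_all add: lact_def)
qed

lemma forbidden_ed_iff:
  "[ed b h i j, ed b' h' i' j'] \<in> forbidden H \<longleftrightarrow>
    b' = (\<not> b) \<and> h' = h \<and> j = 0 \<and> i' = 0 \<and>
    h \<in> hedges H \<and> i < length (ends b h) \<and> j' < length (ends b h)"
  by (auto simp: forbidden_eq)

lemma joins_ed_ed:
  "joins (ed b h i j) (ed b' h' i' j') \<longleftrightarrow> ends (\<not> b) h ! j = ends b' h' ! i' \<and>
    \<not> (b' = (\<not> b) \<and> h' = h \<and> j = 0 \<and> i' = 0 \<and>
        h \<in> hedges H \<and> i < length (ends b h) \<and> j' < length (ends b h))"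
  by (simp add: joins_def forbidden_ed_iff)

lemma source_in_verts: "x \<in> edge_gens H \<Longrightarrow> source x \<in> verts H"
  and range_of_in_verts: "x \<in> edge_gens H \<Longrightarrow> range_of x \<in> verts H"
  by (erule edge_gensE, simp add: ends_in_verts)+

lemma gens_iff: "x \<in> gens H \<longleftrightarrow> (\<exists>v\<in>verts H. x = Vertex v) \<or> x \<in> edge_gens H"
  by (auto simp: gens_def)

lemma vact_irred: "v \<in> verts H \<Longrightarrow> irred w \<Longrightarrow> vact v w \<in> keys_in {w. irred w \<and> w \<noteq> []}"
  by (auto simp: vact_def split: list.splits)

text \<open>The outer index enters the definition of forbidden words only through its bound, and
  \<open>i\<close> satisfies that bound.\<close>

lemma joins_change_index:
  assumes "joins (ed b h i j) y" "ed b h i j \<in> edge_gens H"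
  shows "joins (ed b h i' j) y"
  using assms by (cases y rule: gen_cases) (auto simp: joins_ed_ed ed_in_edge_gens, simp add: joins_def)

lemma irred_change_index:
  assumes "irred (ed b h i j # w)" "i' < length (ends b h)"
  shows "irred (ed b h i' j # w)"
  using assms by (auto simp: irred_ed_Cons ed_in_edge_gens intro: joins_change_index)

text \<open>The middle pair is allowed since its inner index \<open>k\<close> is positive, and at
  the front of \<open>w\<close> only an outer index has changed. Hence one rewriting step already
  ends in irreducible words.\<close>

lemma irred_reduct_word:
  assumes "irred (ed (\<not> b) h 0 j # w)" "i < length (ends b h)" "1 \<le> k"
    "k < length (ends (\<not> b) h)"
  shows "irred (ed b h i k # ed (\<not> b) h k j # w)"
  using irred_change_index[OF assms(1,4)] assms
  by (simp add: irred_ed_Cons[of b] joins_ed_ed) (auto simp: irred_ed_Cons ed_in_edge_gens)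

lemma lact_irred_Cons:
  assumes "x \<in> edge_gens H" "irred (x # w)"
  shows "lact x w = mono_word (x # w)"
proof -
  obtain b h i j where x: "x = ed b h i j"
    using assms(1) by (rule edge_gensE)
  show ?thesis
  proof (cases w)
    case (Cons y z)
    then show ?thesis
      using assms by (cases y rule: gen_cases) (auto simp: x irred_ed_Cons lact_ed_joins)
  qed (simp add: x)
qed

text \<open>Nonemptiness matters: no generator leads back to the empty word, so the values of
  \<open>nf\<close> on the nonunital algebra involve nod-paths only.\<close>

lemma lact_irred:
  assumes "x \<in> gens H" "irred w"
  shows "lact x w \<in> keys_in {w. irred w \<and> w \<noteq> []}"
proof (cases x rule: gen_cases)
  case (Vertex v)
  then show ?thesis
    using assms vact_irred by (auto simp: gens_def)
next
  case (ed b h i j)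
  then have x: "ed b h i j \<in> edge_gens H"
    using assms by (auto simp: gens_def)
  then have h: "h \<in> hedges H" "i < length (ends b h)" "j < length (ends (\<not> b) h)"
    by (auto simp: ed_in_edge_gens)
  show ?thesis
  proof (cases w)
    case Nil
    then show ?thesis
      using x by (simp add: ed irred_ed_Cons)
  next
    case (Cons y z)
    show ?thesis
    proof (cases y rule: gen_cases)
      case (Vertex v)
      then show ?thesis
        using x by (simp add: ed Cons lact_ed_Vertex irred_ed_Cons)
    next
      case y: (ed b' h' i' j')
      consider "ends (\<not> b) h ! j \<noteq> source y" | "joins x y"
        | "b' = (\<not> b)" "h' = h" "j = 0" "i' = 0" "j' < length (ends b h)"
        using joins_ed_ed[of b h i j b' h' i' j'] by (auto simp: ed y)
      then show ?thesis
      proof cases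
        case 1
        then show ?thesis
          by (simp add: ed Cons lact_ed_neq)
      next
        case 2
        then have "irred (x # w)"
          using x assms(2) by (auto simp: ed Cons y irred_ed_Cons)
        then show ?thesis
          using 2 by (simp add: ed Cons y lact_ed_joins)
      next
        case 3
        have "reduct b h i j' z \<in> keys_in {w. irred w \<and> w \<noteq> []}"
          unfolding reduct_def
        proof (intro pm.subspace_diff[OF subspace_keys_in] pm.subspace_sum[OF subspace_keys_in])
          show "(if i = j' then vact (ends b h ! i) z else 0) \<in> keys_in {w. irred w \<and> w \<noteq> []}"
            using assms(2) h by (auto simp: Cons y 3 irred_ed_Cons intro!: vact_irred ends_in_verts)
          show "mono_word (ed b h i k # ed (\<not> b) h k j' # z) \<in> keys_in {w. irred w \<and> w \<noteq> []}"
            if "k \<in> {1..<length (ends (\<not> b) h)}" for k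
            using assms(2) h that by (simp add: Cons y 3 irred_reduct_word)
        qed
        then show ?thesis
          using 3 h by (simp add: ed Cons y lact_forbidden)
      qed
    qed
  qed
qed

section \<open>The action of words and of the free algebra\<close>

fun wact ::
    "('v, 'h) gen list \<Rightarrow> (('v, 'h) gen word \<Rightarrow>\<^sub>0 'k::field) \<Rightarrow> ('v, 'h) gen word \<Rightarrow>\<^sub>0 'k"
  where "wact [] f = f" | "wact (x # xs) f = linext (lact x) (wact xs f)"

lemma linear_wact: "linear_poly (wact xs)"
proof (induction xs)
  case Nil
  then show ?case
    by (simp add: pm.module_hom_ident)
next
  case (Cons x xs)
  then show ?case
    using linear_poly_comp[OF linear_linext[of "lact x"]] by simp
qed

lemma wact_append: "wact (xs @ ys) f = wact xs (wact ys f)"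
  by (induction xs) auto

lemma wact_in_keys_in:
  assumes "set xs \<subseteq> gens H" "f \<in> keys_in {w. irred w}"
  shows "wact xs f \<in> keys_in {w. irred w}"
  using assms(1)
proof (induction xs)
  case (Cons x xs)
  then have "linext (lact x) (wact xs f) \<in> keys_in {w. irred w \<and> w \<noteq> []}"
    by (intro linext_in_subspace[OF subspace_keys_in, of _ "{w. irred w}"]) (auto intro: lact_irred)
  then show ?case
    by (auto elim: keys_in_mono)
qed (use assms in simp)

definition pact ::
    "(('v, 'h) gen word \<Rightarrow>\<^sub>0 'k) \<Rightarrow> (('v, 'h) gen word \<Rightarrow>\<^sub>0 'k::field) \<Rightarrow> ('v, 'h) gen word \<Rightarrow>\<^sub>0 'k"
  where "pact f g = linext (\<lambda>xs. wact xs g) f"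

lemma pact_mono_word [simp]: "pact (mono_word xs) g = wact xs g"
  by (simp add: pact_def)

lemma linear_pact_left: "linear_poly (\<lambda>f. pact f g)"
  unfolding pact_def by (rule linear_linext)

lemma linear_pact_right:
  fixes f :: "('v, 'h) gen word \<Rightarrow>\<^sub>0 'k::field"
  shows "linear_poly (pact f)"
proof (rule linear_polyI)
  show "pact f (g + g') = pact f g + pact f g'" for g g'
    by (simp add: pact_def linext_def module_hom.add[OF linear_wact] pm.scale_right_distrib sum.distrib)
  show "pact f (smult c g) = smult c (pact f g)" for c g
    by (simp add: pact_def linext_def module_hom.scale[OF linear_wact] pm.scale_sum_right mult.commute)
qed

text \<open>Linearity in each factor reduces the module law to concatenation of words.\<close>

lemma pact_times:
  fixes f g h :: "('v, 'h) gen word \<Rightarrow>\<^sub>0 'k::field"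
  shows "pact (f * g) h = pact f (pact g h)"
proof (rule linear_poly_eqI[where F = "\<lambda>f. pact (f * g) h" and G = "\<lambda>f. pact f (pact g h)"])
  show "linear_poly (\<lambda>f. pact (f * g) h)"
    by (rule linear_poly_comp[OF linear_pact_left linear_poly_times_right])
  show "linear_poly (\<lambda>f. pact f (pact g h))"
    by (rule linear_pact_left)
  fix u :: "('v, 'h) gen word"
  have "pact (mono_word (letters u) * g) h = wact (letters u) (pact g h)"
  proof (rule linear_poly_eqI[where F = "\<lambda>g. pact (mono_word (letters u) * g) h"
        and G = "\<lambda>g. wact (letters u) (pact g h)"])
    show "linear_poly (\<lambda>g. pact (mono_word (letters u) * g) h)"
      by (rule linear_poly_comp[OF linear_pact_left linear_poly_times_left])
    show "linear_poly (\<lambda>g. wact (letters u) (pact g h))"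
      by (rule linear_poly_comp[OF linear_wact linear_pact_left])
  qed (simp add: wact_append flip: mono_word_append)
  then show "pact (mono_word (letters u) * g) h = pact (mono_word (letters u)) (pact g h)"
    by simp
qed

section \<open>The relations act as zero\<close>

lemma vact_vact: "linext (vact u) (vact v w) = (if u = v then vact u w else 0)"
  by (auto simp: vact_def split: list.splits)

lemma vact_Nil: "vact v [] = mono_word [Vertex v]"
  by (simp add: vact_def)

lemma vact_Cons: "vact v (y # z) = (if source y = v then mono_word (y # z) else 0)"
  by (simp add: vact_def)

lemma lact_cases [consumes 2, case_names Nil Vertex neq joins forbidden]:
  assumes "x = ed b h i j" "x \<in> edge_gens H"
  obtains "w = []" | v z where "w = Vertex v # z" | y z where "w = y # z" "range_of x \<noteq> source y"
  | y z where "w = y # z" "\<And>v. y \<noteq> Vertex v" "joins x y"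
  | l z where "w = ed (\<not> b) h 0 l # z" "j = 0" "l < length (ends b h)"
proof (cases w)
  case (Cons y z)
  show thesis
  proof (cases y rule: gen_cases)
    case (ed b' h' i' j')
    then show thesis
      using that Cons joins_ed_ed[of b h i j b' h' i' j'] assms(1)
      by (cases "joins x y"; cases "range_of x = source y"; auto)
  qed (use that Cons in blast)
qed (use that in blast)

lemma lact_source:
  assumes "x \<in> edge_gens H"
  shows "linext (vact (source x)) (lact x w) = lact x w"
proof -
  obtain b h i j where x: "x = ed b h i j" "h \<in> hedges H" "i < length (ends b h)"
    "j < length (ends (\<not> b) h)"
    using assms by (rule edge_gensE)
  from x(1) assms show ?thesis
  proof (cases rule: lact_cases[where w = w])
    case (joins y z)
    then show ?thesis
      by (cases y rule: gen_cases) (auto simp: x(1) lact_ed_joins vact_Cons)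
  next
    case (forbidden l z)
    then show ?thesis
      using x by (simp add: lact_forbidden reduct_def linext_diff linext_sum vact_Cons vact_vact)
  qed (auto simp: x(1) lact_ed_Vertex lact_ed_neq vact_Cons)
qed

lemma lact_range:
  assumes "x \<in> edge_gens H"
  shows "linext (lact x) (vact (range_of x) w) = lact x w"
proof -
  obtain b h i j where x: "x = ed b h i j"
    using assms by (rule edge_gensE)
  show ?thesis
    by (cases w) (auto simp: x vact_Nil vact_Cons lact_ed_Vertex lact_ed_neq)
qed

lemma sum_split_first: "0 < (n::nat) \<Longrightarrow> sum f {..<n} = f 0 + sum f {1..<n}"
  by (simp add: lessThan_atLeast0 sum.atLeast_Suc_lessThan)

text \<open>The summands with \<open>k \<ge> 1\<close> are plain concatenations, and the summand
  \<open>k = 0\<close> is a \<open>reduct\<close>, which subtracts exactly these.\<close>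

lemma sum_lact_ed_ed:
  assumes "h \<in> hedges H" "i < length (ends b h)" "j < length (ends b h)"
  shows "(\<Sum>k<length (ends (\<not> b) h). lact (ed b h i k) (ed (\<not> b) h k j # z)) =
    (if i = j then vact (ends b h ! i) z else 0)"
proof -
  have "(\<Sum>k\<in>{1..<length (ends (\<not> b) h)}. lact (ed b h i k) (ed (\<not> b) h k j # z)) =
      (\<Sum>k\<in>{1..<length (ends (\<not> b) h)}. mono_word (ed b h i k # ed (\<not> b) h k j # z))"
    by (intro sum.cong refl lact_ed_joins) (auto simp: joins_ed_ed)
  moreover have "0 < length (ends (\<not> b) h)"
    using assms ends_pos by blast
  ultimately show ?thesis
    using assms by (simp only: sum_split_first lact_forbidden reduct_def) simp
qed

text \<open>The core of the uniqueness of normal forms. Usually the right-hand letters meet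
  \<open>w\<close> in the same way for all \<open>k\<close>, and the claim is immediate or follows
  from \<open>sum_lact_ed_ed\<close>. The exception is the overlap of the two kinds of forbidden
  words.\<close>

lemma lact_sum_relation:
  assumes h: "h \<in> hedges H" and i: "i < length (ends b h)" and j: "j < length (ends b h)"
    and w: "irred w"
  shows "(\<Sum>k<length (ends (\<not> b) h). linext (lact (ed b h i k)) (lact (ed (\<not> b) h k j) w)) =
    (if i = j then vact (ends b h ! i) w else 0 :: ('v, 'h) gen word \<Rightarrow>\<^sub>0 'k::field)"
proof -
  \<comment> \<open>The letter with \<open>k = 0\<close> stands for all summands in the case
    distinction: neither the range nor the way of meeting \<open>w\<close> depends on the outer
    index \<open>k\<close>.\<close>
  have x: "ed (\<not> b) h 0 j \<in> edge_gens H"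
    using assms ends_pos by (auto simp: ed_in_edge_gens)
  from refl x show ?thesis
  proof (cases rule: lact_cases[where w = w])
    case Nil
    then show ?thesis
      by (simp add: sum_lact_ed_ed[OF h i j])
  next
    case (Vertex v z)
    then have "z = []"
      using w by simp
    then show ?thesis
      using Vertex
      by (cases "i = j"; cases "ends b h ! j = v")
        (simp_all add: lact_ed_Vertex vact_Cons vact_Nil sum_lact_ed_ed[OF h i j, of "[]"]
          sum_lact_ed_ed[OF h j j, of "[]"])
  next
    case (neq y z)
    then show ?thesis
      by (auto simp: vact_Cons lact_ed_neq)
  next
    case (joins y z)
    have y: "y \<in> edge_gens H"
      using w joins(1,2) by (cases y rule: gen_cases) (auto simp: irred_ed_Cons)
    have 0: "irred (ed (\<not> b) h 0 j # w)"
      unfolding irred_ed_Cons using w x y joins(1,3) by simp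
    have "lact (ed (\<not> b) h k j) w = (mono_word (ed (\<not> b) h k j # w) :: ('v, 'h) gen word \<Rightarrow>\<^sub>0 'k)"
      if "k < length (ends (\<not> b) h)" for k
    proof (rule lact_irred_Cons)
      show "ed (\<not> b) h k j \<in> edge_gens H"
        using h j that by (simp add: ed_in_edge_gens)
      show "irred (ed (\<not> b) h k j # w)"
        using 0 that by (rule irred_change_index)
    qed
    then show ?thesis
      by (simp add: sum_lact_ed_ed[OF h i j])
  next
    case (forbidden l z)
    \<comment> \<open>The overlap: \<open>w\<close> begins with \<open>ed b h 0 l\<close> and
      \<open>j = 0\<close>, so every inner product is a \<open>reduct\<close>. Its vertex part
      survives only for \<open>k = l\<close>; its other words are summed over \<open>k\<close>
      first, where \<open>sum_lact_ed_ed\<close> applies.\<close>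
    let ?n = "length (ends (\<not> b) h)"
    have l: "l < ?n"
      using forbidden by simp
    have lact_w: "lact (ed (\<not> b) h k 0) w = (reduct (\<not> b) h k l z :: ('v, 'h) gen word \<Rightarrow>\<^sub>0 'k)" if "k < ?n" for k
      using that forbidden h l by (simp add: lact_forbidden[of h k "\<not> b" l z, simplified])
    have "(\<Sum>k<?n. linext (lact (ed b h i k)) (if k = l then vact (ends (\<not> b) h ! k) z else 0)) =
        (linext (lact (ed b h i l)) (vact (ends (\<not> b) h ! l) z) :: ('v, 'h) gen word \<Rightarrow>\<^sub>0 'k)"
      using l by (simp add: if_distrib[of "linext _"] cong: if_cong)
    also have "\<dots> = lact (ed b h i l) z"
      using lact_range[of "ed b h i l" z] h i l by (simp add: ed_in_edge_gens)
    also have "\<dots> = mono_word (ed b h i l # z)"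
    proof (rule lact_irred_Cons)
      show "ed b h i l \<in> edge_gens H"
        using h i l by (simp add: ed_in_edge_gens)
      show "irred (ed b h i l # z)"
        using w i forbidden(1) by (auto intro: irred_change_index)
    qed
    finally have 1: "(\<Sum>k<?n. linext (lact (ed b h i k)) (if k = l then vact (ends (\<not> b) h ! k) z else 0)) =
        (mono_word (ed b h i l # z) :: ('v, 'h) gen word \<Rightarrow>\<^sub>0 'k)" .
    have 2: "(\<Sum>k<?n. lact (ed b h i k) (ed (\<not> b) h k m # ed b h m l # z)) =
        (if i = m then mono_word (ed b h i l # z) else 0 :: ('v, 'h) gen word \<Rightarrow>\<^sub>0 'k)" if "m < length (ends b h)" for m
      by (simp only: sum_lact_ed_ed[OF h i that] vact_Cons source_ed) simp
    have "(\<Sum>k<?n. linext (lact (ed b h i k)) (lact (ed (\<not> b) h k j) w)) =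
       (mono_word (ed b h i l # z) :: ('v, 'h) gen word \<Rightarrow>\<^sub>0 'k) -
        (\<Sum>k<?n. \<Sum>m\<in>{1..<length (ends b h)}. lact (ed b h i k) (ed (\<not> b) h k m # ed b h m l # z))"
      unfolding 1[symmetric] sum_subtractf[symmetric]
      by (intro sum.cong refl)
        (simp only: forbidden(2) lact_w lessThan_iff reduct_def not_not linext_diff linext_sum
          linext_mono_word)
    also have "\<dots> = mono_word (ed b h i l # z) -
        (\<Sum>m\<in>{1..<length (ends b h)}. if i = m then mono_word (ed b h i l # z) else 0)"
      by (subst sum.swap) (simp add: 2)
    \<comment> \<open>The sum over \<open>m\<close> omits \<open>0\<close>: for
      \<open>i \<ge> 1\<close> it cancels the leading word, and for \<open>i = 0 = j\<close> that
      word is \<open>w\<close> itself.\<close>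
    also have "\<dots> = (if i = j then vact (ends b h ! i) w else 0)"
      using forbidden i by (auto simp: vact_Cons)
    finally show ?thesis .
  qed
qed

section \<open>Counting edges\<close>

definition edge_count :: "('v, 'h) gen list \<Rightarrow> nat"
  where "edge_count w = length (filter (\<lambda>x. \<forall>v. x \<noteq> Vertex v) w)"

lemma edge_count_simps [simp]:
  "edge_count [] = 0"
  "edge_count (Vertex v # w) = edge_count w"
  "edge_count (ed b h i j # w) = Suc (edge_count w)"
  "edge_count (u @ w) = edge_count u + edge_count w"
  by (simp_all add: edge_count_def)

lemma edge_count_edges: "set w \<subseteq> edge_gens H \<Longrightarrow> edge_count w = length w"
  unfolding edge_count_def by (subst filter_True) auto

lemma irred_edge_count_0: "irred w \<Longrightarrow> w \<noteq> [] \<Longrightarrow> edge_count w = 0 \<longleftrightarrow> (\<exists>v. w = [Vertex v])"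
  using edge_count_edges by (auto simp: irred_def)

lemma irred_edge_count_pos: "irred w \<Longrightarrow> 0 < edge_count w \<Longrightarrow> set w \<subseteq> edge_gens H"
  by (auto simp: irred_def)

text \<open>\<open>edge_count\<close> is additive on all words, while \<open>path_length\<close>
  also counts the vertices of mixed words. On nod-paths the two agree, so estimates can be made with
  the additive one.\<close>

lemma path_length_eq: "irred w \<Longrightarrow> w \<noteq> [] \<Longrightarrow> path_length w = edge_count w"
  using edge_count_edges[of w] by (auto simp: path_length_def irred_def)

lemma vact_edge_count: "vact v w \<in> keys_in {u. edge_count u \<le> edge_count w}"
  by (auto simp: vact_def split: list.splits)

text \<open>A rewriting step replaces two edges by two edges or drops both.\<close>

lemma lact_edge_count:
  assumes "x \<in> gens H"
  shows "lact x w \<in> keys_in {u. edge_count u \<le> edge_count (x # w)}"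
proof (cases "x \<in> edge_gens H")
  case False
  then show ?thesis
    using assms vact_edge_count by (auto simp: gens_def)
next
  case True
  then obtain b h i j where x: "x = ed b h i j" "h \<in> hedges H" "i < length (ends b h)"
    by (rule edge_gensE)
  from x(1) True show ?thesis
  proof (cases rule: lact_cases[where w = w])
    case (joins y z)
    then show ?thesis
      by (cases y rule: gen_cases) (auto simp: x(1) lact_ed_joins)
  next
    case (forbidden l z)
    have "vact (ends b h ! i) z \<in> keys_in {u. edge_count u \<le> edge_count (x # w)}"
      by (rule keys_in_mono[OF vact_edge_count]) (auto simp: x(1) forbidden)
    then have "reduct b h i l z \<in> keys_in {u. edge_count u \<le> edge_count (x # w)}"
      unfolding reduct_def
      by (intro pm.subspace_diff[OF subspace_keys_in] pm.subspace_sum[OF subspace_keys_in])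
        (auto simp: x(1) forbidden)
    then show ?thesis
      by (simp add: x(1) forbidden lact_forbidden[OF x(2,3)])
  qed (auto simp: x(1) lact_ed_Vertex lact_ed_neq)
qed

lemma wact_edge_count:
  assumes "set xs \<subseteq> gens H" "f \<in> keys_in {u. edge_count u \<le> n}"
  shows "wact xs f \<in> keys_in {u. edge_count u \<le> edge_count xs + n}"
  using assms(1)
proof (induction xs)
  case (Cons x xs)
  then have "wact xs f \<in> keys_in {u. edge_count u \<le> edge_count xs + n}"
    by simp
  moreover have "lact x w \<in> keys_in {u. edge_count u \<le> edge_count (x # xs) + n}"
    if "w \<in> {u. edge_count u \<le> edge_count xs + n}" for w
    using Cons.prems that
    by (intro keys_in_mono[OF lact_edge_count]) (cases x rule: gen_cases; auto)+
  ultimately show ?case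
    unfolding wact.simps by (rule linext_in_subspace[OF subspace_keys_in])
qed (use assms in simp)

text \<open>Mirror image of \<open>joins_change_index\<close>; it keeps the junction to the left
  intact when a rewriting step changes the second index of the last edge of a path.\<close>

lemma joins_change_index_right:
  assumes "joins x (ed b h i j)" "ed b h i j \<in> edge_gens H"
  shows "joins x (ed b h i j')"
proof -
  have "[x, ed b h i j] \<in> forbidden H" if "[x, ed b h i j'] \<in> forbidden H"
  proof -
    obtain b' i' where "x = ed b' h i' 0"
      using \<open>[x, ed b h i j'] \<in> forbidden H\<close> by (auto simp: forbidden_eq)
    then show ?thesis
      using \<open>[x, ed b h i j'] \<in> forbidden H\<close> assms(2) by (auto simp: forbidden_ed_iff ed_in_edge_gens)
  qed
  then show ?thesis
    using assms(1) by (auto simp: joins_def)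
qed

end

section \<open>Normal forms\<close>

text \<open>The parameter \<open>K\<close> only fixes the field of coefficients.\<close>

locale leavitt_algebra = leavitt_setting H S R
  for H :: "('v, 'h) hypergraph" and S R :: "'h \<Rightarrow> 'v list" +
  fixes K :: "'k::field itself"
begin

section \<open>The relations and the ideal they generate\<close>

definition relations :: "(('v, 'h) gen word \<Rightarrow>\<^sub>0 'k) set"
  where "relations = relations_i H \<union> relations_ii H S R \<union> relations_iii H S \<union> relations_iv H R"

definition sum_relation ::
    "bool \<Rightarrow> 'h \<Rightarrow> nat \<Rightarrow> nat \<Rightarrow> ('v, 'h) gen word \<Rightarrow>\<^sub>0 'k"
  where "sum_relation b h i j =
    (\<Sum>k<length (ends (\<not> b) h). mono_word [ed b h i k, ed (\<not> b) h k j]) -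
      (if i = j then mono_word [Vertex (ends b h ! i)] else 0)"

lemma sum_relation_True:
  assumes "h \<in> hedges H"
  shows "sum_relation True h i j = (\<Sum>k<size (rng H h). mono_word [Edge h i k, Ghost h j k]) -
    (if i = j then mono_word [Vertex (S h ! i)] else 0)"
  using size_rng[OF assms] by (simp add: sum_relation_def ends_def)

lemma sum_relation_False:
  assumes "h \<in> hedges H"
  shows "sum_relation False h i j = (\<Sum>k<size (src H h). mono_word [Ghost h k i, Edge h k j]) -
    (if i = j then mono_word [Vertex (R h ! i)] else 0)"
  using size_src[OF assms] by (simp add: sum_relation_def ends_def)

lemma relations_iii_eq:
  "relations_iii H S = {sum_relation True h i j | h i j.
    h \<in> hedges H \<and> i < length (ends True h) \<and> j < length (ends True h)}"
  unfolding relations_iii_def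
  by (intro Collect_cong iff_exI) (auto simp: size_src sum_relation_True simp del: if_split)

lemma relations_iv_eq:
  "relations_iv H R = {sum_relation False h i j | h i j.
    h \<in> hedges H \<and> i < length (ends False h) \<and> j < length (ends False h)}"
  unfolding relations_iv_def
  by (intro Collect_cong iff_exI) (auto simp: size_rng sum_relation_False simp del: if_split)

lemma sum_relation_in_relations:
  assumes "h \<in> hedges H" "i < length (ends b h)" "j < length (ends b h)"
  shows "sum_relation b h i j \<in> relations"
  using assms unfolding relations_def relations_iii_eq relations_iv_eq by (cases b) auto

lemma
  assumes "x \<in> edge_gens H"
  shows source_relation_in_relations: "mono_word [Vertex (source x), x] - mono_word [x] \<in> relations"
    and range_relation_in_relations: "mono_word [x, Vertex (range_of x)] - mono_word [x] \<in> relations"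
proof -
  obtain h i j where h: "h \<in> hedges H" "i < size (src H h)" "j < size (rng H h)"
    and x: "x = Edge h i j \<or> x = Ghost h i j"
    using assms by (auto simp: edge_gens_def)
  have "mono_word [Vertex (source x), x] - mono_word [x] \<in> (relations_ii H S R :: (('v, 'h) gen word \<Rightarrow>\<^sub>0 'k) set)"
    unfolding relations_ii_def using h x
    by (intro UN_I[of h] UN_I[of i] UN_I[of j]) auto
  moreover have "mono_word [x, Vertex (range_of x)] - mono_word [x] \<in> (relations_ii H S R :: (('v, 'h) gen word \<Rightarrow>\<^sub>0 'k) set)"
    unfolding relations_ii_def using h x
    by (intro UN_I[of h] UN_I[of i] UN_I[of j]) auto
  ultimately show "mono_word [Vertex (source x), x] - mono_word [x] \<in> relations"
    "mono_word [x, Vertex (range_of x)] - mono_word [x] \<in> relations"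
    by (simp_all add: relations_def)
qed

lemma vertex_relation_in_relations:
  assumes "u \<in> verts H" "v \<in> verts H"
  shows "mono_word [Vertex u, Vertex v] - (if u = v then mono_word [Vertex u] else 0) \<in> relations"
  using assms unfolding relations_def relations_i_def by blast

lemma relations_cases [consumes 1, case_names vertex source range sum]:
  assumes "r \<in> relations"
  obtains u v where "u \<in> verts H" "v \<in> verts H"
      "r = mono_word [Vertex u, Vertex v] - (if u = v then mono_word [Vertex u] else 0)"
  | x where "x \<in> edge_gens H" "r = mono_word [Vertex (source x), x] - mono_word [x]"
  | x where "x \<in> edge_gens H" "r = mono_word [x, Vertex (range_of x)] - mono_word [x]"
  | b h i j where "h \<in> hedges H" "i < length (ends b h)" "j < length (ends b h)"
      "r = sum_relation b h i j"
proof -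
  consider "r \<in> relations_i H" | "r \<in> relations_ii H S R" | "r \<in> relations_iii H S"
    | "r \<in> relations_iv H R"
    using assms by (auto simp: relations_def)
  then show thesis
  proof cases
    case 1
    then show thesis
      using that(1) unfolding relations_i_def by blast
  next
    case 2
    then obtain h i j where h: "h \<in> hedges H" "i < size (src H h)" "j < size (rng H h)"
      and r: "r \<in> {mono_word [Vertex (S h ! i), Edge h i j] - mono_word [Edge h i j],
       mono_word [Edge h i j, Vertex (R h ! j)] - mono_word [Edge h i j],
       mono_word [Vertex (R h ! j), Ghost h i j] - mono_word [Ghost h i j],
       mono_word [Ghost h i j, Vertex (S h ! i)] - mono_word [Ghost h i j]}"
      unfolding relations_ii_def by blast
    have "Edge h i j \<in> edge_gens H" "Ghost h i j \<in> edge_gens H"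
      using h by (auto simp: edge_gens_def)
    with r show thesis
      using that(2,3)[of "Edge h i j"] that(2,3)[of "Ghost h i j"] by auto
  next
    case 3
    then show thesis
      using that(4) unfolding relations_iii_eq by blast
  next
    case 4
    then show thesis
      using that(4) unfolding relations_iv_eq by blast
  qed
qed

abbreviation A :: "(('v, 'h) gen word \<Rightarrow>\<^sub>0 'k) set"
  where "A \<equiv> keys_in {xs. xs \<noteq> [] \<and> set xs \<subseteq> gens H}"

abbreviation I :: "(('v, 'h) gen word \<Rightarrow>\<^sub>0 'k) set"
  where "I \<equiv> leavitt_ideal H S R"

abbreviation normal :: "(('v, 'h) gen word \<Rightarrow>\<^sub>0 'k) set"
  where "normal \<equiv> keys_in {w. irred w \<and> w \<noteq> []}"

lemma edge_gens_subset_gens: "x \<in> edge_gens H \<Longrightarrow> x \<in> gens H"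
  by (simp add: gens_def)

lemma relations_subset: "relations \<subseteq> A"
proof
  fix r :: "('v, 'h) gen word \<Rightarrow>\<^sub>0 'k" assume "r \<in> relations"
  then show "r \<in> A"
  proof (cases rule: relations_cases)
    case (sum b h i j)
    then have "ed b h i k \<in> gens H" "ed (\<not> b) h k j \<in> gens H" if "k < length (ends (\<not> b) h)" for k
      using that by (auto intro: edge_gens_subset_gens simp: ed_in_edge_gens)
    moreover have "Vertex (ends b h ! i) \<in> gens H"
      using sum ends_in_verts by (simp add: gens_def)
    ultimately show ?thesis
      unfolding sum(4) sum_relation_def
      by (auto intro!: pm.subspace_diff[OF subspace_keys_in] pm.subspace_sum[OF subspace_keys_in])
  qed (auto intro!: pm.subspace_diff[OF subspace_keys_in] edge_gens_subset_gens
      source_in_verts range_of_in_verts simp: gens_iff)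
qed

lemma leavitt_ideal_eq: "I = generated_ideal (gens H) relations"
  by (simp add: leavitt_ideal_def relations_def)

lemma algebra_ideal_I: "algebra_ideal (gens H) I"
  unfolding leavitt_ideal_eq by (intro algebra_ideal_generated) (simp add: carrier_free_algebra relations_subset)

lemma relations_subset_I: "relations \<subseteq> I"
  unfolding leavitt_ideal_eq by (rule generated_ideal_superset)

lemma subspace_I: "pm.subspace I"
  by (rule algebra_ideal_subspace[OF algebra_ideal_I])

lemma zero_in_I [simp]: "0 \<in> I"
  by (rule pm.subspace_0[OF subspace_I])

lemma I_subset: "I \<subseteq> A"
  using algebra_ideal_I by (simp add: algebra_ideal_def carrier_free_algebra)

lemma I_times_left: "a \<in> A \<Longrightarrow> f \<in> I \<Longrightarrow> a * f \<in> I"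
  and I_times_right: "a \<in> A \<Longrightarrow> f \<in> I \<Longrightarrow> f * a \<in> I"
  using algebra_ideal_I by (simp_all add: algebra_ideal_def carrier_free_algebra)

lemma pact_relation:
  assumes "r \<in> relations" "irred w"
  shows "pact r (mono_word w) = 0"
  using assms(1)
proof (cases rule: relations_cases)
  case (vertex u v)
  then show ?thesis
    by (auto simp: pact_def linext_diff vact_vact)
next
  case (source x)
  then show ?thesis
    by (simp add: pact_def linext_diff lact_source)
next
  case (range x)
  then show ?thesis
    by (simp add: pact_def linext_diff lact_range)
next
  case (sum b h i j)
  then have "pact r (mono_word w) =
      (\<Sum>k<length (ends (\<not> b) h). linext (lact (ed b h i k)) (lact (ed (\<not> b) h k j) w)) -
        (if i = j then vact (ends b h ! i) w else 0)"
    by (simp add: pact_def sum_relation_def linext_diff linext_sum)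
  then show ?thesis
    by (simp only: lact_sum_relation[OF sum(1-3) assms(2)] diff_self)
qed

lemma pact_in_keys_in:
  assumes "f \<in> A" "g \<in> keys_in {w. irred w}"
  shows "pact f g \<in> keys_in {w. irred w}"
  unfolding pact_def
  by (rule linext_in_subspace[OF subspace_keys_in assms(1)]) (use assms(2) wact_in_keys_in in auto)

lemma pact_eq_0:
  assumes "\<And>w. irred w \<Longrightarrow> pact f (mono_word w) = 0" "g \<in> keys_in {w. irred w}"
  shows "pact f g = 0"
proof -
  have "pact f g \<in> {0}"
    by (rule linear_poly_in_subspace[OF linear_pact_right pm.subspace_single_0])
      (use assms in \<open>auto simp: keys_in_def\<close>)
  then show ?thesis
    by simp
qed

text \<open>The annihilator \<open>N\<close> of the span of the irreducible words is an ideal, and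
  it contains the relations.\<close>

lemma pact_I:
  assumes "f \<in> I" "g \<in> keys_in {w. irred w}"
  shows "pact f g = 0"
proof -
  define N :: "(('v, 'h) gen word \<Rightarrow>\<^sub>0 'k) set"
    where "N = {f \<in> A. \<forall>w. irred w \<longrightarrow> pact f (mono_word w) = 0}"
  have "algebra_ideal (gens H) N"
    unfolding algebra_ideal_def
  proof (intro conjI ballI allI)
    show "N \<subseteq> carrier (free_algebra (gens H))"
      by (auto simp: N_def carrier_free_algebra)
    show "0 \<in> N"
      by (simp add: N_def pact_def)
    show "f + g \<in> N" if "f \<in> N" "g \<in> N" for f g
      using that by (auto simp: N_def pact_def linext_add intro: pm.subspace_add subspace_keys_in)
    show "smult c f \<in> N" if "f \<in> N" for c f
      using that by (auto simp: N_def pact_def linext_smult intro: pm.subspace_scale subspace_keys_in)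
    fix a f :: "('v, 'h) gen word \<Rightarrow>\<^sub>0 'k"
    assume "a \<in> carrier (free_algebra (gens H))" "f \<in> N"
    then have a: "a \<in> A" and f: "f \<in> A" "\<And>w. irred w \<Longrightarrow> pact f (mono_word w) = 0"
      by (simp_all add: N_def carrier_free_algebra)
    show "a * f \<in> N"
      using a f carrier_times[of a "gens H" f]
      by (simp add: N_def pact_times carrier_free_algebra module_hom.zero[OF linear_pact_right])
    \<comment> \<open>\<open>a\<close> maps irreducible words to combinations of irreducible words,
      and \<open>f\<close> kills each of these.\<close>
    have "pact f (pact a (mono_word w)) = 0" if "irred w" for w
      by (rule pact_eq_0[OF f(2) pact_in_keys_in[OF a]]) (use that in simp_all)
    then show "f * a \<in> N"
      using a f carrier_times[of f "gens H" a] by (simp add: N_def pact_times carrier_free_algebra)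
  qed
  moreover have "relations \<subseteq> N"
    using relations_subset pact_relation by (auto simp: N_def)
  ultimately have "I \<subseteq> N"
    unfolding leavitt_ideal_eq by (rule generated_ideal_minimal)
  with assms(1) have "pact f (mono_word w) = 0" if "irred w" for w
    using that by (auto simp: N_def)
  then show ?thesis
    using assms(2) by (rule pact_eq_0)
qed

section \<open>The normal form of an element of the free algebra\<close>

definition nf :: "(('v, 'h) gen word \<Rightarrow>\<^sub>0 'k) \<Rightarrow> ('v, 'h) gen word \<Rightarrow>\<^sub>0 'k"
  where "nf f = pact f (mono_word [])"

lemma linear_nf: "linear_poly nf"
  unfolding nf_def by (rule linear_pact_left)

lemma nf_diff: "nf (f - g) = nf f - nf g"
  and nf_smult: "nf (smult c f) = smult c (nf f)"
  and nf_zero [simp]: "nf 0 = 0"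
  and nf_sum: "nf (sum F T) = (\<Sum>a\<in>T. nf (F a))"
  by (rule module_hom.diff module_hom.scale module_hom.zero module_hom.sum, rule linear_nf)+

lemma nf_I: "f \<in> I \<Longrightarrow> nf f = 0"
  unfolding nf_def by (rule pact_I) simp_all

text \<open>Building \<open>p\<close> letter by letter from its right end never produces a forbidden
  word, so no rewriting takes place.\<close>

lemma wact_irred: "irred p \<Longrightarrow> wact p (mono_word []) = (mono_word p :: ('v, 'h) gen word \<Rightarrow>\<^sub>0 'k)"
proof (induction p)
  case (Cons x p)
  show ?case
  proof (cases "x \<in> edge_gens H")
    case True
    then show ?thesis
      using Cons by (auto simp: irred_Cons_edge lact_irred_Cons)
  next
    case False
    then obtain v where "x = Vertex v" "p = []"
      using Cons.prems by (auto simp: irred_def)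
    then show ?thesis
      by (simp add: vact_Nil)
  qed
qed simp

lemma nf_normal:
  assumes "f \<in> normal"
  shows "nf f = f"
  by (rule linear_poly_eqI[OF linear_nf pm.module_hom_ident])
    (use assms in \<open>auto simp: keys_in_def nf_def wact_irred\<close>)

lemma nf_in_normal:
  assumes "f \<in> A"
  shows "nf f \<in> normal"
  unfolding nf_def pact_def
proof (rule linext_in_subspace[OF subspace_keys_in assms])
  fix xs :: "('v, 'h) gen list"
  assume "xs \<in> {xs. xs \<noteq> [] \<and> set xs \<subseteq> gens H}"
  then obtain x ys where xs: "xs = x # ys" "x \<in> gens H" "set ys \<subseteq> gens H"
    by (cases xs) auto
  then have "wact ys (mono_word []) \<in> keys_in {w. irred w}"
    by (intro wact_in_keys_in) simp_all
  then show "wact xs (mono_word []) \<in> normal"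
    unfolding xs wact.simps
    by (rule linext_in_subspace[OF subspace_keys_in]) (use xs in \<open>auto intro: lact_irred\<close>)
qed

section \<open>Every element is congruent to its normal form\<close>

abbreviation cong_I :: "(('v, 'h) gen word \<Rightarrow>\<^sub>0 'k) \<Rightarrow> (('v, 'h) gen word \<Rightarrow>\<^sub>0 'k) \<Rightarrow> bool"
    (infix "\<approx>" 50)
  where "f \<approx> g \<equiv> f - g \<in> I"

lemma cong_I_refl [simp]: "f \<approx> f"
  by simp

lemma cong_I_sym: "f \<approx> g \<Longrightarrow> g \<approx> f"
  using pm.subspace_neg[OF subspace_I] by fastforce

lemma cong_I_trans [trans]: "f \<approx> g \<Longrightarrow> g \<approx> h \<Longrightarrow> f \<approx> h"
  using pm.subspace_add[OF subspace_I, of "f - g" "g - h"] by simp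

lemma relation_cong_I: "f - g \<in> relations \<Longrightarrow> f \<approx> g"
  using relations_subset_I by blast

text \<open>The ideal absorbs only factors from the nonunital algebra, so the empty word, which is
  the unit, is treated apart.\<close>

lemma cong_I_times_left:
  assumes "f \<approx> g" "set z \<subseteq> gens H"
  shows "mono_word z * f \<approx> mono_word z * g"
proof (cases "z = []")
  case False
  then show ?thesis
    using I_times_left[of "mono_word z" "f - g"] assms by (simp add: right_diff_distrib)
qed (use assms in \<open>simp add: mono_word_Nil\<close>)

lemma cong_I_times_right:
  assumes "f \<approx> g" "set z \<subseteq> gens H"
  shows "f * mono_word z \<approx> g * mono_word z"
proof (cases "z = []")
  case False
  then show ?thesis
    using I_times_right[of "mono_word z" "f - g"] assms by (simp add: left_diff_distrib)
qed (use assms in \<open>simp add: mono_word_Nil\<close>)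

lemma irred_set: "irred w \<Longrightarrow> set w \<subseteq> gens H"
  by (auto simp: irred_def gens_def)

lemma mono_word_Cons: "mono_word (x # w) = mono_word [x] * mono_word w"
  by (simp flip: mono_word_append)

lemma vact_cong_I:
  assumes "v \<in> verts H" "irred w"
  shows "mono_word (Vertex v # w) \<approx> vact v w"
proof (cases w)
  case Nil
  then show ?thesis
    by (simp add: vact_Nil)
next
  case (Cons y z)
  have z: "set z \<subseteq> gens H"
    using irred_set[OF assms(2)] Cons by simp
  have vv: "mono_word [Vertex v, Vertex u] \<approx> (if v = u then mono_word [Vertex v] else 0)"
    if "u \<in> verts H" for u
    using vertex_relation_in_relations[OF assms(1) that] by (rule relation_cong_I)
  show ?thesis
  proof (cases y rule: gen_cases)
    case (Vertex u)
    then show ?thesis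
      using assms(2) vv[of u] Cons by (auto simp: vact_Cons split: if_splits)
  next
    case (ed b h i j)
    then have y: "y \<in> edge_gens H"
      using assms(2) Cons by (simp add: irred_ed_Cons)
    have sy: "mono_word [Vertex (source y), y] \<approx> mono_word [y]"
      by (rule relation_cong_I[OF source_relation_in_relations[OF y]])
    show ?thesis
    proof (cases "source y = v")
      case True
      have "mono_word [Vertex v, y] * mono_word z \<approx> mono_word [y] * mono_word z"
        using sy z unfolding True by (rule cong_I_times_right)
      then show ?thesis
        using True by (simp add: Cons vact_Cons flip: mono_word_append)
    next
      case False
      \<comment> \<open>Inserting the source of \<open>y\<close> costs nothing modulo the ideal, and
        the product of \<open>v\<close> with this other vertex is zero there.\<close>
      have "mono_word [Vertex v] * mono_word [Vertex (source y), y] * mono_word z \<approx>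
          mono_word [Vertex v] * mono_word [y] * mono_word z"
        using assms(1) by (intro cong_I_times_right cong_I_times_left sy z) (simp add: gens_def)
      then have 1: "mono_word (Vertex v # Vertex (source y) # y # z) \<approx> mono_word (Vertex v # y # z)"
        by (simp flip: mono_word_append)
      have "mono_word [Vertex v, Vertex (source y)] * mono_word (y # z) \<approx> 0 * mono_word (y # z)"
        using vv[OF source_in_verts[OF y]] False irred_set[OF assms(2)] Cons
        by (intro cong_I_times_right) simp_all
      then have 2: "mono_word (Vertex v # Vertex (source y) # y # z) \<approx> 0"
        by (simp flip: mono_word_append)
      show ?thesis
        using False cong_I_trans[OF cong_I_sym[OF 1] 2] by (simp add: Cons vact_Cons)
    qed
  qed
qed

lemma lact_cong_I:
  assumes "x \<in> gens H" "irred w"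
  shows "mono_word (x # w) \<approx> lact x w"
proof (cases "x \<in> edge_gens H")
  case False
  then show ?thesis
    using assms vact_cong_I by (auto simp: gens_def)
next
  case True
  then obtain b h i j where x: "x = ed b h i j" "h \<in> hedges H" "i < length (ends b h)"
    "j < length (ends (\<not> b) h)"
    by (rule edge_gensE)
  have range: "mono_word [x, Vertex (range_of x)] \<approx> mono_word [x]"
    by (rule relation_cong_I[OF range_relation_in_relations[OF True]])
  \<comment> \<open>The range of \<open>x\<close> is inserted after \<open>x\<close> and then acts
    on \<open>w\<close>; this gives zero when \<open>x\<close> and \<open>w\<close> do not
    compose.\<close>
  have "mono_word [x, Vertex (range_of x)] * mono_word w \<approx> mono_word [x] * mono_word w"
    using range irred_set[OF assms(2)] by (rule cong_I_times_right)
  then have 1: "mono_word (x # Vertex (range_of x) # w) \<approx> mono_word (x # w)"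
    by (simp flip: mono_word_append)
  have "mono_word [x] * mono_word (Vertex (range_of x) # w) \<approx> mono_word [x] * vact (range_of x) w"
    using vact_cong_I[OF range_of_in_verts[OF True] assms(2)] assms(1)
    by (intro cong_I_times_left) simp_all
  then have 2: "mono_word (x # Vertex (range_of x) # w) \<approx> mono_word [x] * vact (range_of x) w"
    by (simp flip: mono_word_append)
  have step: "mono_word (x # w) \<approx> mono_word [x] * vact (range_of x) w"
    using cong_I_sym[OF 1] 2 by (rule cong_I_trans)
  from x(1) True show ?thesis
  proof (cases rule: lact_cases[where w = w])
    case Nil
    then show ?thesis
      by (simp add: x(1))
  next
    case (joins y z)
    have "y \<in> edge_gens H"
      using assms(2) joins by (cases y rule: gen_cases) (auto simp: irred_ed_Cons)
    then have "irred (x # w)"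
      using True assms(2) joins by (simp add: irred_Cons_edge)
    then show ?thesis
      using True by (simp add: lact_irred_Cons)
  next
    case (forbidden l z)
    let ?n = "length (ends (\<not> b) h)"
    let ?m = "\<lambda>k. mono_word (ed b h i k # ed (\<not> b) h k l # z) :: ('v, 'h) gen word \<Rightarrow>\<^sub>0 'k"
    have z: "irred z"
      using assms(2) forbidden by (auto simp: irred_ed_Cons)
    have "sum_relation b h i l \<in> I"
      using sum_relation_in_relations[OF x(2,3) forbidden(3)] relations_subset_I by blast
    then have "sum_relation b h i l * mono_word z \<approx> 0 * mono_word z"
      using irred_set[OF z] by (intro cong_I_times_right) simp_all
    moreover have "sum_relation b h i l * mono_word z =
        (\<Sum>k<?n. ?m k) - (if i = l then mono_word (Vertex (ends b h ! i) # z) else 0)"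
      by (simp add: sum_relation_def left_diff_distrib sum_distrib_right flip: mono_word_append)
    ultimately have 1: "(\<Sum>k<?n. ?m k) \<approx> (if i = l then mono_word (Vertex (ends b h ! i) # z) else 0)"
      by simp
    have "(if i = l then mono_word (Vertex (ends b h ! i) # z) else 0) \<approx>
        (if i = l then vact (ends b h ! i) z else 0)"
      using vact_cong_I[OF ends_in_verts[OF x(2,3)] z] by auto
    from cong_I_trans[OF 1 this] have "?m 0 + (\<Sum>k\<in>{1..<?n}. ?m k) \<approx>
        (if i = l then vact (ends b h ! i) z else 0)"
      using x(4) by (simp only: sum_split_first forbidden)
    \<comment> \<open>The relation is solved for its only forbidden summand.\<close>
    then have "?m 0 \<approx> reduct b h i l z"
      by (simp only: reduct_def algebra_simps)
    then show ?thesis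
      by (simp add: forbidden(1,2) x(1) lact_forbidden[OF x(2,3) forbidden(3)])
  next
    case (Vertex v z)
    then have w: "w = [Vertex v]" and v: "v \<in> verts H"
      using assms(2) by auto
    show ?thesis
    proof (cases "range_of x = v")
      case True
      then show ?thesis
        using range by (simp add: w x(1) lact_ed_Vertex)
    next
      case False
      then show ?thesis
        using step by (simp add: w x(1) lact_ed_Vertex vact_Cons)
    qed
  next
    case (neq y z)
    then show ?thesis
      using step by (simp add: x(1) lact_ed_neq vact_Cons)
  qed
qed

lemma nf_cong_I:
  assumes "f \<in> A"
  shows "f \<approx> nf f"
proof -
  have word: "mono_word xs \<approx> wact xs (mono_word [])" if "set xs \<subseteq> gens H" for xs
    using that
  proof (induction xs)
    case Nil
    then show ?case
      by simp
  next
    case (Cons x xs)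
    let ?g = "wact xs (mono_word []) :: ('v, 'h) gen word \<Rightarrow>\<^sub>0 'k"
    have "mono_word [x] * mono_word xs \<approx> mono_word [x] * ?g"
      using Cons by (intro cong_I_times_left) simp_all
    moreover have "mono_word [x] * ?g - linext (lact x) ?g \<in> I"
    proof (rule linear_poly_in_subspace[OF _ subspace_I, where f = ?g])
      show "linear_poly (\<lambda>g. mono_word [x] * g - linext (lact x) g)"
        by (intro linear_poly_diff linear_poly_times_left linear_linext)
      fix u assume "u \<in> Poly_Mapping.keys ?g"
      moreover have "?g \<in> keys_in {w. irred w}"
        using Cons by (intro wact_in_keys_in) simp_all
      ultimately have "irred (letters u)"
        by (auto simp: keys_in_def)
      then show "mono_word [x] * mono_word (letters u) - linext (lact x) (mono_word (letters u)) \<in> I"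
        using Cons lact_cong_I by (simp flip: mono_word_append)
    qed
    ultimately show ?case
      unfolding mono_word_Cons[of x xs] wact.simps by (rule cong_I_trans)
  qed
  show ?thesis
  proof (rule linear_poly_in_subspace[OF _ subspace_I, where f = f])
    show "linear_poly (\<lambda>f. f - nf f)"
      by (intro linear_poly_diff linear_nf pm.module_hom_ident)
    fix u assume "u \<in> Poly_Mapping.keys f"
    then have "set (letters u) \<subseteq> gens H"
      using assms by (auto simp: keys_in_def)
    then show "mono_word (letters u) - nf (mono_word (letters u)) \<in> I"
      using word by (simp add: nf_def)
  qed
qed

lemma in_I_iff: "f \<in> A \<Longrightarrow> f \<in> I \<longleftrightarrow> nf f = 0"
  using nf_I nf_cong_I[of f] by auto

section \<open>The ring of cosets\<close>

abbreviation LPA :: "(('v, 'h) gen word \<Rightarrow>\<^sub>0 'k) set ring"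
  where "LPA \<equiv> leavitt_path_algebra H S R"

definition cls :: "(('v, 'h) gen word \<Rightarrow>\<^sub>0 'k) \<Rightarrow> (('v, 'h) gen word \<Rightarrow>\<^sub>0 'k) set"
  where "cls f = I +>\<^bsub>free_algebra (gens H)\<^esub> f"

lemma A_times: "f \<in> A \<Longrightarrow> g \<in> A \<Longrightarrow> f * g \<in> A"
  using carrier_times[of f "gens H" g] by (simp add: carrier_free_algebra)

lemma subspace_A: "pm.subspace A"
  by (rule subspace_keys_in)

lemma cls_eq: "cls f = {g. g \<approx> f}"
proof (intro equalityI subsetI)
  fix g assume "g \<in> {g. g \<approx> f}"
  then have "g - f \<in> I" "g = (g - f) + f"
    by simp_all
  then show "g \<in> cls f"
    by (auto simp: cls_def a_r_coset_def' free_algebra_def intro!: bexI[of _ "g - f"])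
qed (auto simp: cls_def a_r_coset_def' free_algebra_def)

lemma in_cls_iff: "g \<in> cls f \<longleftrightarrow> g \<approx> f"
  by (simp add: cls_eq)

lemma cls_eq_iff: "cls f = cls g \<longleftrightarrow> f \<approx> g"
proof
  assume "cls f = cls g"
  then show "f \<approx> g"
    using cong_I_refl[of f] by (simp only: flip: in_cls_iff)
next
  assume *: "f \<approx> g"
  show "cls f = cls g"
    unfolding cls_eq using * by (auto intro: cong_I_trans[OF _ *] cong_I_trans[OF _ cong_I_sym[OF *]])
qed

lemma zero_LPA: "\<zero>\<^bsub>LPA\<^esub> = cls 0"
  by (simp add: leavitt_path_algebra_def FactRing_def cls_eq)

lemma carrier_LPA: "carrier LPA = cls ` A"
  by (auto simp: leavitt_path_algebra_def FactRing_def A_RCOSETS_def' cls_def carrier_free_algebra)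

lemma add_LPA: "cls f \<oplus>\<^bsub>LPA\<^esub> cls g = cls (f + g)"
proof -
  have "cls f \<oplus>\<^bsub>LPA\<^esub> cls g = {a + b | a b. a \<approx> f \<and> b \<approx> g}"
    unfolding in_cls_iff[symmetric]
    by (simp add: leavitt_path_algebra_def FactRing_def set_add_def' free_algebra_def) blast
  also have "\<dots> = cls (f + g)"
  proof (intro equalityI subsetI)
    fix c assume "c \<in> {a + b | a b. a \<approx> f \<and> b \<approx> g}"
    then obtain a b where c: "c = a + b" "a \<approx> f" "b \<approx> g"
      by blast
    then have "(a - f) + (b - g) \<in> I"
      by (intro pm.subspace_add[OF subspace_I])
    then show "c \<in> cls (f + g)"
      by (simp add: in_cls_iff c(1) algebra_simps)
  next
    fix c assume "c \<in> cls (f + g)"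
    then have "c - g \<approx> f"
      by (simp add: in_cls_iff algebra_simps)
    then have "c = (c - g) + g \<and> c - g \<approx> f \<and> g \<approx> g"
      by simp
    then show "c \<in> {a + b | a b. a \<approx> f \<and> b \<approx> g}"
      by (intro CollectI exI)
  qed
  finally show ?thesis .
qed

lemma cong_I_in_A: "f \<approx> g \<Longrightarrow> g \<in> A \<Longrightarrow> f \<in> A"
  using pm.subspace_add[OF subspace_A, of "f - g" g] I_subset by auto

text \<open>The product of cosets is a union of cosets over all pairs of representatives. All these
  cosets coincide by $ab - fg = a(b-g) + (a-f)g$, and the union is not empty.\<close>

lemma mult_LPA:
  assumes "f \<in> A" "g \<in> A"
  shows "cls f \<otimes>\<^bsub>LPA\<^esub> cls g = cls (f * g)"
proof -
  have *: "cls (a * b) = cls (f * g)" if "a \<in> cls f" "b \<in> cls g" for a b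
  proof -
    have ab: "a \<approx> f" "b \<approx> g"
      using that by (simp_all only: in_cls_iff)
    have "a * (b - g) \<in> I" "(a - f) * g \<in> I"
      using I_times_left[OF cong_I_in_A[OF ab(1) assms(1)] ab(2)] I_times_right[OF assms(2) ab(1)]
      by simp_all
    then have "a * (b - g) + (a - f) * g \<in> I"
      by (rule pm.subspace_add[OF subspace_I])
    then show ?thesis
      by (simp add: cls_eq_iff algebra_simps)
  qed
  have "cls f \<otimes>\<^bsub>LPA\<^esub> cls g = (\<Union>a\<in>cls f. \<Union>b\<in>cls g. cls (a * b))"
    by (simp add: leavitt_path_algebra_def FactRing_def rcoset_mult_def cls_def free_algebra_def)
  also have "\<dots> = (\<Union>a\<in>cls f. \<Union>b\<in>cls g. cls (f * g))"
    by (intro SUP_cong refl *)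
  also have "\<dots> = cls (f * g)"
  proof -
    have "f \<in> cls f" "g \<in> cls g"
      by (simp_all add: in_cls_iff)
    then show ?thesis
      by blast
  qed
  finally show ?thesis .
qed

lemma abelian_group_LPA: "abelian_group LPA"
proof (rule abelian_groupI)
  fix x assume "x \<in> carrier LPA"
  then obtain f where f: "f \<in> A" "x = cls f"
    by (auto simp: carrier_LPA)
  show "\<zero>\<^bsub>LPA\<^esub> \<oplus>\<^bsub>LPA\<^esub> x = x"
    by (simp add: f zero_LPA add_LPA)
  show "\<exists>y\<in>carrier LPA. y \<oplus>\<^bsub>LPA\<^esub> x = \<zero>\<^bsub>LPA\<^esub>"
  proof
    show "cls (- f) \<oplus>\<^bsub>LPA\<^esub> x = \<zero>\<^bsub>LPA\<^esub>"
      by (simp add: f zero_LPA add_LPA)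
    show "cls (- f) \<in> carrier LPA"
      using f pm.subspace_neg[OF subspace_A] by (simp add: carrier_LPA)
  qed
qed (auto simp: carrier_LPA zero_LPA add_LPA add_ac
    intro!: imageI pm.subspace_add[OF subspace_A])

lemma nonunital_ring_LPA: "nonunital_ring LPA"
proof -
  interpret abelian_group LPA
    by (rule abelian_group_LPA)
  show ?thesis
    by unfold_locales
      (auto simp: carrier_LPA add_LPA mult_LPA A_times pm.subspace_add[OF subspace_A] algebra_simps)
qed

lemma minus_LPA:
  assumes "f \<in> A" "g \<in> A"
  shows "cls f \<ominus>\<^bsub>LPA\<^esub> cls g = cls (f - g)"
proof -
  interpret abelian_group LPA
    by (rule abelian_group_LPA)
  have "\<ominus>\<^bsub>LPA\<^esub> cls g = cls (- g)"
    using assms pm.subspace_neg[OF subspace_A]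
    by (intro minus_equality) (auto simp: add_LPA zero_LPA carrier_LPA)
  then show ?thesis
    by (simp add: a_minus_def add_LPA)
qed

section \<open>Cosets represented by normal forms\<close>

lemma normal_subset_A: "normal \<subseteq> A"
  using irred_set by (auto simp: keys_in_def)

lemma cls_nf: "f \<in> A \<Longrightarrow> cls (nf f) = cls f"
  using nf_cong_I[of f] cong_I_sym by (auto simp: cls_eq_iff)

lemma cls_eq_iff_nf: "f \<in> A \<Longrightarrow> g \<in> A \<Longrightarrow> cls f = cls g \<longleftrightarrow> nf f = nf g"
  using in_I_iff[of "f - g"] pm.subspace_diff[OF subspace_A] by (simp add: cls_eq_iff nf_diff)

text \<open>Existence of the normal representative comes from rewriting (\<open>nf_cong_I\<close>),
  its uniqueness from the action (\<open>nf_I\<close>, \<open>nf_normal\<close>).\<close>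

lemma NF_cls:
  assumes "f \<in> A"
  shows "NF H S R (cls f) = nf f"
proof -
  have "{p. nod_path H S R p} = {w. irred w \<and> w \<noteq> []}"
    by (simp add: nod_path_iff)
  then have "NF H S R (cls f) = (THE g. g \<approx> f \<and> g \<in> normal)"
    by (simp only: NF_def in_cls_iff keys_subset_Word_iff)
  also have "\<dots> = nf f"
  proof (rule the_equality)
    show "nf f \<approx> f \<and> nf f \<in> normal"
      using assms nf_in_normal nf_cong_I cong_I_sym by blast
    show "g = nf f" if "g \<approx> f \<and> g \<in> normal" for g
      using that nf_I[of "g - f"] by (simp add: nf_diff nf_normal)
  qed
  finally show ?thesis .
qed

lemma LPA_cases:
  assumes "x \<in> carrier LPA"
  obtains f where "f \<in> normal" "x = cls f"
proof -
  obtain g where "g \<in> A" "x = cls g"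
    using assms by (auto simp: carrier_LPA)
  then show thesis
    using that[of "nf g"] nf_in_normal cls_nf by simp
qed

section \<open>Vertices as local units\<close>

abbreviation vertex :: "'v \<Rightarrow> ('v, 'h) gen word \<Rightarrow>\<^sub>0 'k"
  where "vertex v \<equiv> mono_word [Vertex v]"

lemma vertex_in_A: "v \<in> verts H \<Longrightarrow> vertex v \<in> A"
  by (simp add: gens_def)

lemma vertex_elements_eq: "vertex_elements H S R = (\<lambda>v. cls (vertex v)) ` verts H"
  by (simp add: vertex_elements_def cls_def)

text \<open>Lets a \<open>finsum\<close> over a set of cosets be computed as a sum over
  vertices.\<close>

lemma inj_on_cls_vertex: "inj_on (\<lambda>v. cls (vertex v)) (verts H)"
proof (rule inj_onI)
  fix u v assume uv: "u \<in> verts H" "v \<in> verts H" "cls (vertex u) = cls (vertex v)"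
  then have "nf (vertex u) = nf (vertex v)"
    using cls_eq_iff_nf vertex_in_A by blast
  then show "u = v"
    using uv by (simp add: nf_normal)
qed

lemma lact_single_Vertex:
  "lact x [Vertex v] = (if range_of x = v then mono_word [x] else 0)"
  by (cases x rule: gen_cases) (auto simp: vact_Cons lact_ed_Vertex)

text \<open>Only the last letter of \<open>p\<close> meets the vertex. It yields itself or zero, and
  the remaining letters rebuild \<open>p\<close> as they do from the empty word.\<close>

lemma nf_times_vertex:
  assumes "irred p" "p \<noteq> []"
  shows "nf (mono_word p * vertex v) = (if range_of (last p) = v then mono_word p else 0)"
proof -
  obtain q x where p: "p = q @ [x]"
    using assms(2) by (cases p rule: rev_cases) auto
  have lact_x: "lact x [] = (mono_word [x] :: ('v, 'h) gen word \<Rightarrow>\<^sub>0 'k)"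
    by (cases x rule: gen_cases) (simp_all add: vact_Nil)
  have "wact q (mono_word [x]) = (mono_word p :: ('v, 'h) gen word \<Rightarrow>\<^sub>0 'k)"
    using wact_irred[OF assms(1)] by (simp add: p wact_append lact_x)
  moreover have "nf (mono_word p * vertex v) = wact q (lact x [Vertex v])"
    by (simp add: p nf_def wact_append vact_Nil flip: mono_word_append)
  ultimately show ?thesis
    by (simp add: p lact_single_Vertex module_hom.zero[OF linear_wact])
qed

lemma nf_vertex_times:
  assumes "irred p" "p \<noteq> []"
  shows "nf (vertex v * mono_word p) = (if source (hd p) = v then mono_word p else 0)"
proof -
  have "nf (vertex v * mono_word p) = vact v p"
    using wact_irred[OF assms(1)] by (simp add: nf_def flip: mono_word_append)
  then show ?thesis
    using assms(2) by (cases p) (simp_all add: vact_Cons)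
qed

lemma nf_times_nf_right:
  assumes "f \<in> A" "g \<in> A"
  shows "nf (f * nf g) = nf (f * g)"
  using nf_I[OF I_times_left[OF assms(1) nf_cong_I[OF assms(2)]]]
  by (simp add: right_diff_distrib nf_diff)

lemma nf_vertex_times_vertex:
  assumes "irred p" "p \<noteq> []" "u \<in> verts H" "v \<in> verts H"
  shows "nf (vertex u * mono_word p * vertex v) =
    (if source (hd p) = u \<and> range_of (last p) = v then mono_word p else 0)"
proof -
  have p: "mono_word p \<in> A"
    using assms(1,2) irred_set by simp
  have "nf (vertex u * mono_word p * vertex v) = nf (vertex u * nf (mono_word p * vertex v))"
    unfolding mult.assoc
    using nf_times_nf_right[OF vertex_in_A[OF assms(3)] A_times[OF p vertex_in_A[OF assms(4)]]] by simp
  then show ?thesis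
    using assms by (simp add: nf_times_vertex nf_vertex_times)
qed

lemma vertex_elements_mult:
  assumes "u \<in> verts H" "v \<in> verts H"
  shows "cls (vertex u) \<otimes>\<^bsub>LPA\<^esub> cls (vertex v) = (if u = v then cls (vertex u) else \<zero>\<^bsub>LPA\<^esub>)"
proof -
  have "mono_word [Vertex u, Vertex v] \<approx> (if u = v then vertex u else 0)"
    by (rule relation_cong_I[OF vertex_relation_in_relations[OF assms]])
  then have "cls (vertex u * vertex v) = cls (if u = v then vertex u else 0)"
    by (simp only: cls_eq_iff append.simps flip: mono_word_append)
  then show ?thesis
    using mult_LPA[OF vertex_in_A[OF assms(1)] vertex_in_A[OF assms(2)]] by (simp add: zero_LPA)
qed

lemma finsum_vertex_elements:
  assumes "finite V" "V \<subseteq> verts H"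
  shows "finsum LPA (\<lambda>e. e) ((\<lambda>v. cls (vertex v)) ` V) = cls (\<Sum>v\<in>V. vertex v)"
  using assms
proof (induction V)
  case empty
  interpret abelian_group LPA
    by (rule abelian_group_LPA)
  show ?case
    by (simp add: zero_LPA)
next
  case (insert v V)
  interpret abelian_group LPA
    by (rule abelian_group_LPA)
  have "cls (vertex v) \<notin> (\<lambda>v. cls (vertex v)) ` V"
    using insert inj_on_cls_vertex by (auto dest: inj_onD)
  moreover have "cls (vertex v) \<in> carrier LPA" if "v \<in> verts H" for v
    using vertex_in_A[OF that] by (simp add: carrier_LPA)
  ultimately show ?case
    using insert by (simp add: finsum_insert add_LPA subset_iff Pi_iff image_iff)
qed

text \<open>When both sums over \<open>V\<close> are expanded, exactly one pair of vertices
  preserves a given path, namely its source and its range.\<close>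

lemma sum_vertex_local_unit:
  assumes "f \<in> normal" "finite V" "V \<subseteq> verts H"
    and ends: "\<And>w. w \<in> Poly_Mapping.keys f \<Longrightarrow>
      source (hd (letters w)) \<in> V \<and> range_of (last (letters w)) \<in> V"
  shows "nf ((\<Sum>v\<in>V. vertex v) * f * (\<Sum>v\<in>V. vertex v)) = f"
proof (rule linear_poly_eqI[OF _ pm.module_hom_ident])
  show "linear_poly (\<lambda>f. nf ((\<Sum>v\<in>V. vertex v) * f * (\<Sum>v\<in>V. vertex v)))"
    by (rule linear_poly_comp[OF linear_nf linear_poly_comp[OF linear_poly_times_right linear_poly_times_left]])
  fix w assume w: "w \<in> Poly_Mapping.keys f"
  let ?p = "letters w"
  have p: "irred ?p" "?p \<noteq> []"
    using w assms(1) by (auto simp: keys_in_def)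
  have "nf ((\<Sum>v\<in>V. vertex v) * mono_word ?p * (\<Sum>v\<in>V. vertex v)) =
      (\<Sum>u\<in>V. \<Sum>v\<in>V. nf (vertex v * mono_word ?p * vertex u))"
    by (simp add: sum_distrib_left sum_distrib_right nf_sum)
  also have "\<dots> = (\<Sum>u\<in>V. \<Sum>v\<in>V. if source (hd ?p) = v then
      (if range_of (last ?p) = u then mono_word ?p else 0) else 0)"
    using assms(3) p by (intro sum.cong refl) (auto simp: nf_vertex_times_vertex subset_iff)
  also have "\<dots> = mono_word ?p"
    using ends[OF w] assms(2) by simp
  finally show "nf ((\<Sum>v\<in>V. vertex v) * mono_word ?p * (\<Sum>v\<in>V. vertex v)) = mono_word ?p" .
qed

lemma irred_hd_last:
  assumes "irred p" "p \<noteq> []"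
  shows "source (hd p) \<in> verts H" "range_of (last p) \<in> verts H"
proof -
  have "hd p \<in> gens H" "last p \<in> gens H"
    using irred_set[OF assms(1)] assms(2) by auto
  then show "source (hd p) \<in> verts H" "range_of (last p) \<in> verts H"
    by (auto simp: gens_iff source_in_verts range_of_in_verts)
qed

lemma ring_with_enough_idempotents_LPA:
  "ring_with_enough_idempotents LPA (vertex_elements H S R)"
proof -
  interpret nonunital_ring LPA
    by (rule nonunital_ring_LPA)
  show ?thesis
  proof
    show "vertex_elements H S R \<subseteq> carrier LPA"
      using vertex_in_A by (auto simp: vertex_elements_eq carrier_LPA)
    show "e \<noteq> \<zero>\<^bsub>LPA\<^esub>" if "e \<in> vertex_elements H S R" for e
    proof -
      obtain v where v: "v \<in> verts H" "e = cls (vertex v)"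
        using \<open>e \<in> vertex_elements H S R\<close> by (auto simp: vertex_elements_eq)
      have "nf (vertex v) \<noteq> 0"
        using v(1) by (simp add: nf_normal)
      then show ?thesis
        using cls_eq_iff_nf[OF vertex_in_A[OF v(1)], of 0] v(2) by (simp add: zero_LPA)
    qed
    show "e \<otimes>\<^bsub>LPA\<^esub> e = e" if "e \<in> vertex_elements H S R" for e
      using that vertex_elements_mult by (auto simp: vertex_elements_eq)
    show "e \<otimes>\<^bsub>LPA\<^esub> f = \<zero>\<^bsub>LPA\<^esub>"
      if "e \<in> vertex_elements H S R" "f \<in> vertex_elements H S R" "e \<noteq> f" for e f
    proof -
      obtain u v where "u \<in> verts H" "v \<in> verts H" "e = cls (vertex u)" "f = cls (vertex v)"
        using \<open>e \<in> _\<close> \<open>f \<in> _\<close> by (auto simp: vertex_elements_eq)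
      then show ?thesis
        using vertex_elements_mult[of u v] \<open>e \<noteq> f\<close> by (cases "u = v") simp_all
    qed
    fix T assume T: "finite T" "T \<subseteq> carrier LPA"
    have NF_normal: "NF H S R t \<in> normal \<and> cls (NF H S R t) = t" if "t \<in> T" for t
      using T(2) that by (auto simp: carrier_LPA NF_cls cls_nf nf_in_normal)
    \<comment> \<open>The end vertices of all nod-paths occurring in elements of \<open>T\<close>;
      both \<open>T\<close> and the supports are finite.\<close>
    define V where "V = (\<Union>t\<in>T. \<Union>w\<in>Poly_Mapping.keys (NF H S R t).
      {source (hd (letters w)), range_of (last (letters w))})"
    let ?U = "\<Sum>v\<in>V. vertex v" and ?F = "(\<lambda>v. cls (vertex v)) ` V"
    have V: "finite V" "V \<subseteq> verts H"
      using T(1) NF_normal irred_hd_last by (auto simp: V_def keys_in_def)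
    have U: "?U \<in> A"
      using V(2) vertex_in_A by (intro pm.subspace_sum[OF subspace_A]) blast
    have "cls ?U \<otimes>\<^bsub>LPA\<^esub> t \<otimes>\<^bsub>LPA\<^esub> cls ?U = t" if t: "t \<in> T" for t
    proof -
      let ?f = "NF H S R t"
      have f: "?f \<in> normal" "?f \<in> A" "t = cls ?f"
        using NF_normal[OF t] normal_subset_A by auto
      have "nf (?U * ?f * ?U) = ?f"
        using f(1) V by (rule sum_vertex_local_unit) (use t in \<open>auto simp: V_def\<close>)
      then have "cls (?U * ?f * ?U) = cls ?f"
        using cls_nf[OF A_times[OF A_times[OF U f(2)] U]] by simp
      then have "cls ?U \<otimes>\<^bsub>LPA\<^esub> cls ?f \<otimes>\<^bsub>LPA\<^esub> cls ?U = cls ?f"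
        by (simp only: mult_LPA[OF U f(2)] mult_LPA[OF A_times[OF U f(2)] U])
      then show ?thesis
        by (simp only: f(3)[symmetric])
    qed
    then show "\<exists>F. finite F \<and> F \<subseteq> vertex_elements H S R \<and>
        (\<forall>t\<in>T. finsum LPA (\<lambda>e. e) F \<otimes>\<^bsub>LPA\<^esub> t \<otimes>\<^bsub>LPA\<^esub> finsum LPA (\<lambda>e. e) F = t)"
      using V finsum_vertex_elements[OF V] by (intro exI[of _ ?F]) (auto simp: vertex_elements_eq)
  qed
qed

end

section \<open>Degrees\<close>

definition word_degree :: "(('v, 'h) gen word \<Rightarrow>\<^sub>0 'k::field) \<Rightarrow> nat extended"
  where "word_degree f = (if f = 0 then Minf
    else Fin (Max ((\<lambda>w. path_length (letters w)) ` Poly_Mapping.keys f)))"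

lemma word_degree_zero_iff: "word_degree f = Minf \<longleftrightarrow> f = 0"
  by (simp add: word_degree_def)

lemma word_degree_eq_FinI:
  assumes "\<And>w. w \<in> Poly_Mapping.keys f \<Longrightarrow> path_length (letters w) \<le> n"
    and "w \<in> Poly_Mapping.keys f" "path_length (letters w) = n"
  shows "word_degree f = Fin n"
proof -
  have "f \<noteq> 0"
    using assms(2) by auto
  moreover have "Max ((\<lambda>w. path_length (letters w)) ` Poly_Mapping.keys f) = n"
    using assms by (intro Max_eqI) auto
  ultimately show ?thesis
    by (simp add: word_degree_def)
qed

lemma word_degree_cases:
  assumes "f \<noteq> 0"
  obtains w where "w \<in> Poly_Mapping.keys f" "word_degree f = Fin (path_length (letters w))"
    "\<And>v. v \<in> Poly_Mapping.keys f \<Longrightarrow> path_length (letters v) \<le> path_length (letters w)"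
proof -
  have ne: "Poly_Mapping.keys f \<noteq> {}"
    using assms by simp
  then have "Max ((\<lambda>w. path_length (letters w)) ` Poly_Mapping.keys f) \<in>
      (\<lambda>w. path_length (letters w)) ` Poly_Mapping.keys f"
    by (intro Max_in) auto
  then obtain w where w: "w \<in> Poly_Mapping.keys f"
    "Max ((\<lambda>w. path_length (letters w)) ` Poly_Mapping.keys f) = path_length (letters w)"
    by auto
  have "path_length (letters v) \<le> path_length (letters w)" if "v \<in> Poly_Mapping.keys f" for v
    unfolding w(2)[symmetric] using that by (intro Max_ge) auto
  then show thesis
    using w assms by (intro that[of w]) (simp_all add: word_degree_def)
qed

lemma word_degree_diff: "word_degree (f - g) \<le> max (word_degree f) (word_degree g)"
proof (cases "f - g = 0")
  case False
  then obtain w where w: "w \<in> Poly_Mapping.keys (f - g)"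
    "word_degree (f - g) = Fin (path_length (letters w))"
    using word_degree_cases by metis
  have "Fin (path_length (letters w)) \<le> word_degree h" if "w \<in> Poly_Mapping.keys h" for h :: "('a, 'b) gen word \<Rightarrow>\<^sub>0 'c"
  proof -
    from that have "h \<noteq> 0"
      by auto
    then show ?thesis
      using that by (auto simp: word_degree_def intro!: Max_ge)
  qed
  moreover have "w \<in> Poly_Mapping.keys f \<or> w \<in> Poly_Mapping.keys g"
    using w(1) by (auto simp: in_keys_iff lookup_minus)
  ultimately show ?thesis
    unfolding w(2) by (auto simp: le_max_iff_disj)
qed (simp add: word_degree_def)

text \<open>The double sum factors into two single sums, each of which picks out one
  coefficient.\<close>

lemma sum_sum_delta_lookup:
  "(\<Sum>p\<in>Poly_Mapping.keys f. \<Sum>q\<in>Poly_Mapping.keys g.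
      Poly_Mapping.lookup f p * (Poly_Mapping.lookup g q * of_bool (letters p = a \<and> letters q = b))) =
    Poly_Mapping.lookup f (Word a) * (Poly_Mapping.lookup g (Word b) :: 'k::field)"
proof -
  have *: "(\<Sum>q\<in>Poly_Mapping.keys g. Poly_Mapping.lookup g q * of_bool (q = c)) = Poly_Mapping.lookup g c"
    for g :: "'x word \<Rightarrow>\<^sub>0 'k" and c
    by (cases "c \<in> Poly_Mapping.keys g")
      (simp_all add: of_bool_def if_distrib[of "(*) _"] in_keys_iff cong: if_cong)
  have "Poly_Mapping.lookup f p * (Poly_Mapping.lookup g q * of_bool (letters p = a \<and> letters q = b)) =
      (Poly_Mapping.lookup f p * of_bool (p = Word a)) * (Poly_Mapping.lookup g q * of_bool (q = Word b))"
    for p q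
    by (cases p; cases q) simp
  then show ?thesis
    by (simp only: sum_product[symmetric] *)
qed

context leavitt_algebra
begin

section \<open>Top coefficients of products\<close>

lemma nf_edge_count:
  assumes "f \<in> keys_in {w. w \<noteq> [] \<and> set w \<subseteq> gens H \<and> edge_count w \<le> n}"
  shows "nf f \<in> keys_in {w. edge_count w \<le> n}"
  unfolding nf_def pact_def
proof (rule linext_in_subspace[OF subspace_keys_in assms])
  fix xs assume "xs \<in> {w. w \<noteq> [] \<and> set w \<subseteq> gens H \<and> edge_count w \<le> n}"
  then show "wact xs (mono_word []) \<in> keys_in {w. edge_count w \<le> n}"
    by (intro keys_in_mono[OF wact_edge_count[of xs "mono_word []" 0]]) auto
qed

lemma nf_times_edge_count:
  assumes "f \<in> keys_in {w. irred w \<and> w \<noteq> [] \<and> edge_count w \<le> m}"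
    and "g \<in> keys_in {w. irred w \<and> w \<noteq> [] \<and> edge_count w \<le> n}"
  shows "nf (f * g) \<in> keys_in {w. edge_count w \<le> m + n}"
  by (rule nf_edge_count, rule times_in_keys_in[OF assms]) (use irred_set in auto)

lemma wact_append_irred:
  assumes "set p \<subseteq> edge_gens H" "set q \<subseteq> edge_gens H" "irred (p @ q)"
  shows "wact p (mono_word q) = (mono_word (p @ q) :: ('v, 'h) gen word \<Rightarrow>\<^sub>0 'k)"
proof -
  have "irred q"
    using assms by (simp add: irred_append)
  then have "wact p (mono_word q) = (wact p (wact q (mono_word [])) :: ('v, 'h) gen word \<Rightarrow>\<^sub>0 'k)"
    by (simp add: wact_irred)
  also have "\<dots> = mono_word (p @ q)"
    using wact_irred[OF assms(3)] by (simp add: wact_append)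
  finally show ?thesis .
qed

lemma nf_times_joins:
  assumes "set p \<subseteq> edge_gens H" "set q \<subseteq> edge_gens H" "irred p" "irred q"
    and "p \<noteq> []" "q \<noteq> []" "joins (last p) (hd q)"
  shows "nf (mono_word p * mono_word q) = mono_word (p @ q)"
proof -
  have "irred (p @ q)"
    using assms by (simp add: irred_append)
  then show ?thesis
    by (simp add: nf_def wact_irred flip: mono_word_append)
qed

text \<open>Separates a remainder \<open>r\<close>, shorter than the product by at least two edges,
  from the words of full length, which alone matter for the degree.\<close>

lemma nf_times_forbidden:
  assumes p: "set p \<subseteq> edge_gens H" "irred (p @ [ed b h i 0])"
    and q: "set q \<subseteq> edge_gens H" "irred (ed (\<not> b) h 0 j # q)"
    and h: "h \<in> hedges H" "i < length (ends b h)" "j < length (ends b h)"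
  obtains r where "r \<in> keys_in {w. edge_count w \<le> length p + length q}"
    "nf (mono_word (p @ [ed b h i 0]) * mono_word (ed (\<not> b) h 0 j # q)) =
      r - (\<Sum>k\<in>{1..<length (ends (\<not> b) h)}. mono_word (p @ ed b h i k # ed (\<not> b) h k j # q))"
proof
  let ?v = "(if i = j then vact (ends b h ! i) q else 0) :: ('v, 'h) gen word \<Rightarrow>\<^sub>0 'k"
  have "(vact (ends b h ! i) q :: ('v, 'h) gen word \<Rightarrow>\<^sub>0 'k) \<in> keys_in {w. edge_count w \<le> length q}"
    using vact_edge_count[of "ends b h ! i" q] unfolding edge_count_edges[OF q(1)] .
  then have "?v \<in> keys_in {w. edge_count w \<le> length q}"
    by (cases "i = j") simp_all
  from wact_edge_count[OF _ this, of p] show "wact p ?v \<in> keys_in {w. edge_count w \<le> length p + length q}"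
    unfolding edge_count_edges[OF p(1)] using p(1) edge_gens_subset_gens by blast
  have "wact p (mono_word (ed b h i k # ed (\<not> b) h k j # q)) =
      (mono_word (p @ ed b h i k # ed (\<not> b) h k j # q) :: ('v, 'h) gen word \<Rightarrow>\<^sub>0 'k)"
    if k: "k \<in> {1..<length (ends (\<not> b) h)}" for k
  proof -
    have in_edges: "ed b h i 0 \<in> edge_gens H" "ed b h i k \<in> edge_gens H"
      "ed (\<not> b) h k j \<in> edge_gens H"
      using h k ends_pos[OF h(1)] by (auto simp: ed_in_edge_gens)
    have "irred (ed b h i k # ed (\<not> b) h k j # q)"
      using q(2) h k by (intro irred_reduct_word) auto
    moreover have "irred p" "p \<noteq> [] \<longrightarrow> joins (last p) (ed b h i k)"
      using p in_edges joins_change_index_right[of "last p" b h i 0 k]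
      by (auto simp: irred_append)
    ultimately have "irred (p @ ed b h i k # ed (\<not> b) h k j # q)"
      using p q in_edges by (subst irred_append) auto
    then show ?thesis
      using p q in_edges by (intro wact_append_irred) auto
  qed
  then have "(\<Sum>k\<in>{1..<length (ends (\<not> b) h)}. wact p (mono_word (ed b h i k # ed (\<not> b) h k j # q))) =
      (\<Sum>k\<in>{1..<length (ends (\<not> b) h)}.
        mono_word (p @ ed b h i k # ed (\<not> b) h k j # q) :: ('v, 'h) gen word \<Rightarrow>\<^sub>0 'k)"
    by (rule sum.cong[OF refl])
  moreover have "nf (mono_word (p @ [ed b h i 0]) * mono_word (ed (\<not> b) h 0 j # q)) =
      wact p (reduct b h i j q)"
    using wact_irred[OF q(2)] by (simp add: nf_def wact_append lact_forbidden[OF h] flip: mono_word_append)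
  ultimately show "nf (mono_word (p @ [ed b h i 0]) * mono_word (ed (\<not> b) h 0 j # q)) =
      wact p ?v - (\<Sum>k\<in>{1..<length (ends (\<not> b) h)}. mono_word (p @ ed b h i k # ed (\<not> b) h k j # q))"
    by (simp only: reduct_def module_hom.diff[OF linear_wact] module_hom.sum[OF linear_wact])
qed

text \<open>The target word has the largest length that the product can reach. It arises only by
  concatenating its two halves, or by rewriting the pair whose inner indices are both
  \<open>0\<close>; the latter contributes with a minus sign.\<close>

lemma lookup_nf_times_top:
  assumes p: "irred p" "p \<noteq> []" "edge_count p \<le> Suc (length u)"
    and q: "irred q" "q \<noteq> []" "edge_count q \<le> Suc (length v)"
    and pq: "range_of (last p) = source (hd q)"
    and uv: "set u \<subseteq> edge_gens H" "x \<in> edge_gens H" "y \<in> edge_gens H" "set v \<subseteq> edge_gens H"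
    and xy: "joins x y"
  shows "Poly_Mapping.lookup (nf (mono_word p * mono_word q)) (Word (u @ x # y # v)) =
    of_bool (p = u @ [x] \<and> q = y # v) -
    of_bool (\<exists>b h i j k. 1 \<le> k \<and> x = ed b h i k \<and> y = ed (\<not> b) h k j \<and>
      p = u @ [ed b h i 0] \<and> q = ed (\<not> b) h 0 j # v)"
    (is "?l = of_bool ?P - of_bool ?Q")
proof -
  have count: "edge_count (u @ x # y # v) = Suc (length u) + Suc (length v)"
    using uv by (subst edge_count_edges) auto
  show ?thesis
  proof (cases "edge_count p = Suc (length u) \<and> edge_count q = Suc (length v)")
    \<comment> \<open>If one factor is too short, the product cannot reach the target.\<close>
    case False
    have "nf (mono_word p * mono_word q) \<in> keys_in {w. edge_count w \<le> edge_count p + edge_count q}"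
      using p q by (intro nf_times_edge_count) simp_all
    then have "?l = 0"
      using False p(3) q(3) count by (force simp: keys_in_def in_keys_iff)
    moreover have "\<not> ?P"
      using False uv by (auto simp: edge_count_edges)
    moreover have "\<not> ?Q"
      using False uv by (auto simp: edge_count_edges)
    ultimately show ?thesis
      by (simp only: of_bool_eq diff_zero)
  next
    case True
    then have pe: "set p \<subseteq> edge_gens H" and qe: "set q \<subseteq> edge_gens H"
      using irred_edge_count_pos p q by auto
    then have len: "length p = Suc (length u)" "length q = Suc (length v)"
      using True by (simp_all add: edge_count_edges)
    show ?thesis
    proof (cases "joins (last p) (hd q)")
      case True
      then have "nf (mono_word p * mono_word q) = mono_word (p @ q)"
        using pe qe p q by (intro nf_times_joins)
      moreover have "u @ x # y # v = p @ q \<longleftrightarrow> ?P"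
        using append_eq_append_conv[of p "u @ [x]" q "y # v"] len by auto
      moreover have "\<not> ?Q"
      proof
        assume ?Q
        then obtain b h i j k where "x = ed b h i k" "y = ed (\<not> b) h k j"
          "last p = ed b h i 0" "hd q = ed (\<not> b) h 0 j"
          by auto
        then show False
          using True uv by (auto simp: joins_ed_ed ed_in_edge_gens)
      qed
      ultimately show ?thesis
        by (simp add: lookup_mono_word)
    next
      case False
      then have "[last p, hd q] \<in> forbidden H"
        using pq by (simp add: joins_def)
      then obtain b h i j where bh: "last p = ed b h i 0" "hd q = ed (\<not> b) h 0 j"
        and h: "h \<in> hedges H" "i < length (ends b h)" "j < length (ends b h)"
        by (auto simp: forbidden_eq)
      define p' q' where "p' = butlast p" and "q' = tl q"
      have p': "p = p' @ [ed b h i 0]" and q': "q = ed (\<not> b) h 0 j # q'"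
        using p(2) q(2) bh unfolding p'_def q'_def by (metis append_butlast_last_id, metis list.collapse)
      obtain r where r: "r \<in> keys_in {w. edge_count w \<le> length p' + length q'}"
        "nf (mono_word p * mono_word q) =
          r - (\<Sum>k\<in>{1..<length (ends (\<not> b) h)}. mono_word (p' @ ed b h i k # ed (\<not> b) h k j # q'))"
        using pe qe p q h unfolding p' q' by (elim nf_times_forbidden[rotated -1]) auto
      have "Poly_Mapping.lookup r (Word (u @ x # y # v)) = 0"
        using r(1) len count unfolding p' q' by (force simp: keys_in_def in_keys_iff)
      moreover have "Poly_Mapping.lookup (\<Sum>k\<in>{1..<length (ends (\<not> b) h)}.
          mono_word (p' @ ed b h i k # ed (\<not> b) h k j # q')) (Word (u @ x # y # v)) =
          (of_bool ?Q :: 'k)"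
      proof -
        have eq: "u @ x # y # v = p' @ ed b h i k # ed (\<not> b) h k j # q' \<longleftrightarrow>
            u = p' \<and> x = ed b h i k \<and> y = ed (\<not> b) h k j \<and> v = q'" for k
          using len unfolding p' q' by auto
        have Q: "(\<exists>k\<in>{1..<length (ends (\<not> b) h)}.
            u = p' \<and> x = ed b h i k \<and> y = ed (\<not> b) h k j \<and> v = q') \<longleftrightarrow> ?Q"
          using uv(2) unfolding p' q' by (auto simp: ed_in_edge_gens)
        have "(\<Sum>k\<in>{1..<length (ends (\<not> b) h)}.
            of_bool (u = p' \<and> x = ed b h i k \<and> y = ed (\<not> b) h k j \<and> v = q')) = (of_bool ?Q :: 'k)"
          \<comment> \<open>The index \<open>k\<close> is determined by \<open>x\<close>, so at most
            one summand is the target.\<close>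
          unfolding Q[symmetric] by (rule sum_of_bool_unique) auto
        then show ?thesis
          by (simp only: lookup_sum lookup_mono_word word.inject eq)
      qed
      \<comment> \<open>The letters at the cut form a forbidden pair, whereas \<open>x\<close> and
        \<open>y\<close> join.\<close>
      moreover have "\<not> ?P"
        using False xy by auto
      ultimately show ?thesis
        by (simp only: r(2) lookup_minus of_bool_eq)
    qed
  qed
qed

lemma path_valuation_cls:
  assumes "f \<in> A"
  shows "path_valuation H S R (cls f) = word_degree (nf f)"
proof -
  have "supp H S R (cls f) = letters ` Poly_Mapping.keys (nf f)"
    unfolding supp_def NF_cls[OF assms] by (force intro: rev_image_eqI)
  then show ?thesis
    by (simp add: path_valuation_def word_degree_def image_image)
qed

lemma lookup_nf_times:
  "Poly_Mapping.lookup (nf (f * g)) W = (\<Sum>p\<in>Poly_Mapping.keys f. \<Sum>q\<in>Poly_Mapping.keys g.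
    Poly_Mapping.lookup f p * (Poly_Mapping.lookup g q *
      Poly_Mapping.lookup (nf (mono_word (letters p) * mono_word (letters q))) W))"
proof -
  have left: "linear_poly (\<lambda>f. nf (f * g))"
    by (rule linear_poly_comp[OF linear_nf linear_poly_times_right])
  have right: "linear_poly (\<lambda>g. nf (mono_word p * g))" for p
    by (rule linear_poly_comp[OF linear_nf linear_poly_times_left])
  show ?thesis
    by (subst linear_poly_expand[OF left], subst linear_poly_expand[OF right])
      (simp add: lookup_sum sum_distrib_left)
qed

text \<open>Among all pairs of support words only the two of \<open>lookup_nf_times_top\<close> can
  contribute, and the second exists only if \<open>x\<close> and \<open>y\<close> are oppositely
  oriented edges of one hyperedge sharing an inner index \<open>k \<ge> 1\<close>.\<close>

lemma
  fixes f g :: "('v, 'h) gen word \<Rightarrow>\<^sub>0 'k"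
  assumes f: "f \<in> keys_in {w. irred w \<and> w \<noteq> [] \<and> range_of (last w) = e \<and> edge_count w \<le> Suc (length u)}"
    and g: "g \<in> keys_in {w. irred w \<and> w \<noteq> [] \<and> source (hd w) = e \<and> edge_count w \<le> Suc (length v)}"
    and uv: "set u \<subseteq> edge_gens H" "x \<in> edge_gens H" "y \<in> edge_gens H" "set v \<subseteq> edge_gens H"
    and xy: "joins x y"
  shows lookup_nf_times_generic: "(\<And>b h i j k. 1 \<le> k \<Longrightarrow> x = ed b h i k \<Longrightarrow> y = ed (\<not> b) h k j \<Longrightarrow> False) \<Longrightarrow>
      Poly_Mapping.lookup (nf (f * g)) (Word (u @ x # y # v)) =
        Poly_Mapping.lookup f (Word (u @ [x])) * Poly_Mapping.lookup g (Word (y # v))"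
    and lookup_nf_times_matching: "1 \<le> k \<Longrightarrow> x = ed b h i k \<Longrightarrow> y = ed (\<not> b) h k j \<Longrightarrow>
      Poly_Mapping.lookup (nf (f * g)) (Word (u @ x # y # v)) =
        Poly_Mapping.lookup f (Word (u @ [x])) * Poly_Mapping.lookup g (Word (y # v)) -
        Poly_Mapping.lookup f (Word (u @ [ed b h i 0])) *
          Poly_Mapping.lookup g (Word (ed (\<not> b) h 0 j # v))"
proof -
  let ?W = "Word (u @ x # y # v)"
  define Q where "Q p q \<longleftrightarrow> (\<exists>b h i j k. 1 \<le> k \<and> x = ed b h i k \<and> y = ed (\<not> b) h k j \<and>
    p = u @ [ed b h i 0] \<and> q = ed (\<not> b) h 0 j # v)" for p q
  have top: "Poly_Mapping.lookup (nf (mono_word (letters p) * mono_word (letters q))) ?W =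
      of_bool (letters p = u @ [x] \<and> letters q = y # v) - of_bool (Q (letters p) (letters q))"
    if "p \<in> Poly_Mapping.keys f" "q \<in> Poly_Mapping.keys g" for p q
    unfolding Q_def
  proof (rule lookup_nf_times_top)
    show "irred (letters p)" "letters p \<noteq> []" "edge_count (letters p) \<le> Suc (length u)"
      "irred (letters q)" "letters q \<noteq> []" "edge_count (letters q) \<le> Suc (length v)"
      "range_of (last (letters p)) = source (hd (letters q))"
      using that f g by (simp_all add: keys_in_def)
  qed fact+
  have sums: "Poly_Mapping.lookup (nf (f * g)) ?W =
      (\<Sum>p\<in>Poly_Mapping.keys f. \<Sum>q\<in>Poly_Mapping.keys g.
        Poly_Mapping.lookup f p * (Poly_Mapping.lookup g q *
          (of_bool (letters p = u @ [x] \<and> letters q = y # v) - of_bool (Q (letters p) (letters q)))))"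
    by (rule trans[OF lookup_nf_times], intro sum.cong refl) (simp only: top)
  {
    assume *: "\<And>b h i j k. 1 \<le> k \<Longrightarrow> x = ed b h i k \<Longrightarrow> y = ed (\<not> b) h k j \<Longrightarrow> False"
    have "\<not> Q p q" for p q
      unfolding Q_def using * by blast
    then have "Q = (\<lambda>_ _. False)"
      by blast
    then show "Poly_Mapping.lookup (nf (f * g)) ?W =
        Poly_Mapping.lookup f (Word (u @ [x])) * Poly_Mapping.lookup g (Word (y # v))"
      unfolding sums by (simp only: of_bool_eq diff_zero sum_sum_delta_lookup)
  next
    assume k: "1 \<le> k" "x = ed b h i k" "y = ed (\<not> b) h k j"
    have "Q p q \<longleftrightarrow> p = u @ [ed b h i 0] \<and> q = ed (\<not> b) h 0 j # v" for p q
      unfolding Q_def k(2,3) using k(1) by (simp only: ed_eq_iff) blast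
    then have "Q = (\<lambda>p q. p = u @ [ed b h i 0] \<and> q = ed (\<not> b) h 0 j # v)"
      by blast
    then show "Poly_Mapping.lookup (nf (f * g)) ?W =
        Poly_Mapping.lookup f (Word (u @ [x])) * Poly_Mapping.lookup g (Word (y # v)) -
        Poly_Mapping.lookup f (Word (u @ [ed b h i 0])) *
          Poly_Mapping.lookup g (Word (ed (\<not> b) h 0 j # v))"
      unfolding sums by (simp only: right_diff_distrib sum_subtractf sum_sum_delta_lookup)
  }
qed

section \<open>Normal forms of elements of $Re$ and $eR$\<close>

abbreviation ends_at :: "'v \<Rightarrow> (('v, 'h) gen word \<Rightarrow>\<^sub>0 'k) set"
  where "ends_at e \<equiv> keys_in {w. irred w \<and> w \<noteq> [] \<and> range_of (last w) = e}"

abbreviation starts_at :: "'v \<Rightarrow> (('v, 'h) gen word \<Rightarrow>\<^sub>0 'k) set"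
  where "starts_at e \<equiv> keys_in {w. irred w \<and> w \<noteq> [] \<and> source (hd w) = e}"

lemma nf_times_vertex_ends_at:
  assumes "f \<in> normal" "v \<in> verts H"
  shows "nf (f * vertex v) \<in> ends_at v"
proof (rule linear_poly_in_subspace[OF _ subspace_keys_in, where f = f])
  show "linear_poly (\<lambda>f. nf (f * vertex v))"
    by (rule linear_poly_comp[OF linear_nf linear_poly_times_right])
  show "nf (mono_word (letters w) * vertex v) \<in> ends_at v" if "w \<in> Poly_Mapping.keys f" for w
    using assms(1) that by (simp add: keys_in_def[of "{w. irred w \<and> w \<noteq> []}"] nf_times_vertex)
qed

lemma nf_vertex_times_starts_at:
  assumes "f \<in> normal" "v \<in> verts H"
  shows "nf (vertex v * f) \<in> starts_at v"
proof (rule linear_poly_in_subspace[OF _ subspace_keys_in, where f = f])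
  show "linear_poly (\<lambda>f. nf (vertex v * f))"
    by (rule linear_poly_comp[OF linear_nf linear_poly_times_left])
  show "nf (vertex v * mono_word (letters w)) \<in> starts_at v" if "w \<in> Poly_Mapping.keys f" for w
    using assms(1) that by (simp add: keys_in_def[of "{w. irred w \<and> w \<noteq> []}"] nf_vertex_times)
qed

lemma nf_times_vertex_id:
  assumes "f \<in> ends_at v"
  shows "nf (f * vertex v) = f"
  by (rule linear_poly_eqI[OF linear_poly_comp[OF linear_nf linear_poly_times_right] pm.module_hom_ident])
    (use assms in \<open>simp add: keys_in_def nf_times_vertex\<close>)

lemma nf_vertex_times_id:
  assumes "f \<in> starts_at v"
  shows "nf (vertex v * f) = f"
  by (rule linear_poly_eqI[OF linear_poly_comp[OF linear_nf linear_poly_times_left] pm.module_hom_ident])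
    (use assms in \<open>simp add: keys_in_def nf_vertex_times\<close>)

text \<open>Describes the factors of degree zero, to which the argument with top coefficients does
  not apply.\<close>

lemma scalar_vertex:
  assumes "\<And>w. w \<in> Poly_Mapping.keys f \<Longrightarrow> letters w = [Vertex v]"
  shows "f = smult (Poly_Mapping.lookup f (Word [Vertex v])) (vertex v)"
proof (rule poly_mapping_eqI)
  fix w
  have "w = Word [Vertex v]" if "w \<in> Poly_Mapping.keys f"
    using assms[OF that] by (cases w) simp
  then show "Poly_Mapping.lookup f w =
      Poly_Mapping.lookup (smult (Poly_Mapping.lookup f (Word [Vertex v])) (vertex v)) w"
    by (cases "w \<in> Poly_Mapping.keys f") (auto simp: lookup_mono_word in_keys_iff)
qed

text \<open>
  The coefficients of the product at the words \<open>u h\<^sub>i\<^sub>k h\<^sub>j\<^sub>l\<^sup>* v\<close> are \<open>P k * Q l\<close> for \<open>k \<noteq> l\<close> and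
  \<open>P k * Q k - P 0 * Q 0\<close> for \<open>k = l \<noteq> 0\<close>. If the former all vanish, at most one index contributes,
  and then one of the latter does not vanish because there are at least two indices.
\<close>

lemma ex_top_coefficient:
  assumes f: "f \<in> ends_at e" "\<And>w. w \<in> Poly_Mapping.keys f \<Longrightarrow> edge_count (letters w) \<le> Suc (length u)"
    and g: "g \<in> starts_at e" "\<And>w. w \<in> Poly_Mapping.keys g \<Longrightarrow> edge_count (letters w) \<le> Suc (length v)"
    and u: "Poly_Mapping.lookup f (Word (u @ [x])) \<noteq> 0" "set (u @ [x]) \<subseteq> edge_gens H"
    and v: "Poly_Mapping.lookup g (Word (y # v)) \<noteq> 0" "set (y # v) \<subseteq> edge_gens H"
    and two: "\<And>h b. h \<in> hedges H \<Longrightarrow> 2 \<le> length (ends b h)"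
  shows "\<exists>x y. x \<in> edge_gens H \<and> y \<in> edge_gens H \<and>
    Poly_Mapping.lookup (nf (f * g)) (Word (u @ x # y # v)) \<noteq> 0"
proof -
  have f': "f \<in> keys_in {w. irred w \<and> w \<noteq> [] \<and> range_of (last w) = e \<and> edge_count w \<le> Suc (length u)}"
    and g': "g \<in> keys_in {w. irred w \<and> w \<noteq> [] \<and> source (hd w) = e \<and> edge_count w \<le> Suc (length v)}"
    using f g by (simp_all add: keys_in_def)
  have uv: "set u \<subseteq> edge_gens H" "set v \<subseteq> edge_gens H"
    using u v by simp_all
  have f_key: "irred (u @ [z]) \<and> range_of z = e" if "Poly_Mapping.lookup f (Word (u @ [z])) \<noteq> 0" for z
  proof -
    have "Word (u @ [z]) \<in> Poly_Mapping.keys f"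
      using that by (simp add: in_keys_iff)
    then show ?thesis
      using f(1) by (auto simp: keys_in_def)
  qed
  have g_key: "irred (z # v) \<and> source z = e" if "Poly_Mapping.lookup g (Word (z # v)) \<noteq> 0" for z
  proof -
    have "Word (z # v) \<in> Poly_Mapping.keys g"
      using that by (simp add: in_keys_iff)
    then show ?thesis
      using g(1) by (auto simp: keys_in_def)
  qed
  note generic = lookup_nf_times_generic[OF f' g' uv(1) _ _ uv(2)]
    and matching = lookup_nf_times_matching[OF f' g' uv(1) _ _ uv(2)]
  have x: "x \<in> edge_gens H" "range_of x = e" and y: "y \<in> edge_gens H" "source y = e"
    using f_key g_key u v by simp_all
  show ?thesis
  \<comment> \<open>Outside this situation the junction is allowed and no rewritten pair leads to
    the same word, so the coefficient is a plain product.\<close>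
  proof (cases "\<exists>b h i j k. x = ed b h i k \<and> y = ed (\<not> b) h k j")
    case False
    have "joins x y"
      using x y False by (auto simp: joins_def forbidden_eq)
    then have "Poly_Mapping.lookup (nf (f * g)) (Word (u @ x # y # v)) =
        Poly_Mapping.lookup f (Word (u @ [x])) * Poly_Mapping.lookup g (Word (y # v))"
      using x y False by (intro generic) blast+
    then show ?thesis
      using u v x(1) y(1) by (intro exI[of _ x] exI[of _ y]) simp
  next
    case True
    then obtain b h i j k where xy: "x = ed b h i k" "y = ed (\<not> b) h k j"
      by blast
    then have h: "h \<in> hedges H" "i < length (ends b h)" "j < length (ends b h)"
      using x y by (simp_all add: ed_in_edge_gens)
    define P where "P l = Poly_Mapping.lookup f (Word (u @ [ed b h i l]))" for l
    define Q where "Q l = Poly_Mapping.lookup g (Word (ed (\<not> b) h l j # v))" for l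
    have PQ: "P k \<noteq> 0" "Q k \<noteq> 0"
      using u v by (simp_all add: P_def Q_def xy)
    show ?thesis
    proof (cases "\<exists>l m. l \<noteq> m \<and> P l \<noteq> 0 \<and> Q m \<noteq> 0")
      case True
      then obtain l m where lm: "l \<noteq> m" "P l \<noteq> 0" "Q m \<noteq> 0"
        by blast
      \<comment> \<open>Nonzero coefficients force the indices \<open>l\<close> and \<open>m\<close>
        into range and make both letters meet at \<open>e\<close>, so that they compose.\<close>
      then have edges: "ed b h i l \<in> edge_gens H" "ends (\<not> b) h ! l = e"
        "ed (\<not> b) h m j \<in> edge_gens H" "ends (\<not> b) h ! m = e"
        using f_key[of "ed b h i l"] g_key[of "ed (\<not> b) h m j"]
        by (auto simp: P_def Q_def irred_def)
      then have "joins (ed b h i l) (ed (\<not> b) h m j)"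
        using lm(1) by (auto simp: joins_ed_ed)
      then have "Poly_Mapping.lookup (nf (f * g)) (Word (u @ ed b h i l # ed (\<not> b) h m j # v)) = P l * Q m"
        unfolding P_def Q_def using edges lm(1) by (intro generic) simp_all
      then show ?thesis
        using edges lm by (metis no_zero_divisors)
    next
      case False
      \<comment> \<open>The inner index of the word to be exhibited must be positive, as index
        \<open>0\<close> is forbidden; \<open>1\<close> is in range because there are at least two
        indices.\<close>
      define l where "l = (if k = 0 then 1 else k)"
      have l: "1 \<le> l" "l < length (ends (\<not> b) h)"
        using two[OF h(1), of "\<not> b"] x(1) by (auto simp: l_def xy ed_in_edge_gens)
      have edges: "ed b h i l \<in> edge_gens H" "ed (\<not> b) h l j \<in> edge_gens H"
        using h l by (simp_all add: ed_in_edge_gens)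
      have "joins (ed b h i l) (ed (\<not> b) h l j)"
        using l by (simp add: joins_ed_ed)
      then have "Poly_Mapping.lookup (nf (f * g)) (Word (u @ ed b h i l # ed (\<not> b) h l j # v)) =
          P l * Q l - P 0 * Q 0"
        unfolding P_def Q_def using edges l by (intro matching) simp_all
      \<comment> \<open>Exactly one of the two products survives: \<open>P k\<close> and
        \<open>Q k\<close> are nonzero, and the other index, \<open>l\<close> if
        \<open>k = 0\<close> and \<open>0\<close> otherwise, has vanishing \<open>P\<close> since it
        differs from \<open>k\<close>.\<close>
      moreover have "P l * Q l - P 0 * Q 0 \<noteq> 0"
      proof (cases "k = 0")
        case True
        then have "P l = 0"
          using False PQ l(1) by (metis not_one_le_zero)
        then show ?thesis
          using True PQ by simp
      next
        case k: False
        then have "P 0 = 0"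
          using False PQ by metis
        then show ?thesis
          using k PQ by (simp add: l_def)
      qed
      ultimately show ?thesis
        using edges by metis
    qed
  qed
qed

text \<open>Edge counts bound the degree from above. The bound is attained: a factor of degree zero
  is a nonzero multiple of the vertex \<open>e\<close>, and otherwise
  \<open>ex_top_coefficient\<close> supplies a word of full length.\<close>

lemma word_degree_nf_times:
  assumes f: "f \<in> ends_at e" and g: "g \<in> starts_at e"
    and two: "\<And>h b. h \<in> hedges H \<Longrightarrow> 2 \<le> length (ends b h)"
  shows "word_degree (nf (f * g)) = word_degree f + word_degree g"
proof (cases "f = 0 \<or> g = 0")
  case True
  then show ?thesis
    by (auto simp: word_degree_def)
next
  case False
  have fn: "f \<in> normal" and gn: "g \<in> normal"
    by (rule keys_in_mono[OF f] keys_in_mono[OF g], blast)+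
  have irred_f: "irred (letters w) \<and> letters w \<noteq> [] \<and> range_of (last (letters w)) = e"
    if "w \<in> Poly_Mapping.keys f" for w
    using f that by (simp add: keys_in_def)
  have irred_g: "irred (letters w) \<and> letters w \<noteq> [] \<and> source (hd (letters w)) = e"
    if "w \<in> Poly_Mapping.keys g" for w
    using g that by (simp add: keys_in_def)
  obtain p where p: "p \<in> Poly_Mapping.keys f" "word_degree f = Fin (path_length (letters p))"
    "\<And>w. w \<in> Poly_Mapping.keys f \<Longrightarrow> path_length (letters w) \<le> path_length (letters p)"
    using False word_degree_cases[of f] by metis
  obtain q where q: "q \<in> Poly_Mapping.keys g" "word_degree g = Fin (path_length (letters q))"
    "\<And>w. w \<in> Poly_Mapping.keys g \<Longrightarrow> path_length (letters w) \<le> path_length (letters q)"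
    using False word_degree_cases[of g] by metis
  let ?p = "letters p" and ?q = "letters q"
  have count_f: "edge_count (letters w) \<le> edge_count ?p" if "w \<in> Poly_Mapping.keys f" for w
    using p(3)[OF that] irred_f[OF that] irred_f[OF p(1)] by (simp add: path_length_eq)
  have count_g: "edge_count (letters w) \<le> edge_count ?q" if "w \<in> Poly_Mapping.keys g" for w
    using q(3)[OF that] irred_g[OF that] irred_g[OF q(1)] by (simp add: path_length_eq)
  have nf_normal_times: "nf (f * g) \<in> normal"
    using fn gn normal_subset_A by (intro nf_in_normal A_times) blast+
  have "\<exists>w\<in>Poly_Mapping.keys (nf (f * g)). edge_count (letters w) = edge_count ?p + edge_count ?q"
  proof (cases "edge_count ?p = 0 \<or> edge_count ?q = 0")
    case True
    then show ?thesis
    proof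
      assume 0: "edge_count ?p = 0"
      have vertex_f: "letters w = [Vertex e]" if "w \<in> Poly_Mapping.keys f" for w
        using count_f[OF that] 0 irred_f[OF that] irred_edge_count_0[of "letters w"] by auto
      have "nf (f * g) = smult (Poly_Mapping.lookup f (Word [Vertex e])) (nf (vertex e * g))"
        by (subst scalar_vertex[OF vertex_f]) (simp_all add: smult_times_left nf_smult)
      then have eq: "nf (f * g) = smult (Poly_Mapping.lookup f (Word [Vertex e])) g"
        by (simp add: nf_vertex_times_id[OF g])
      have "Poly_Mapping.lookup f (Word [Vertex e]) \<noteq> 0"
        using p(1) vertex_f[OF p(1)] by (cases p) (simp add: in_keys_iff)
      then have "q \<in> Poly_Mapping.keys (nf (f * g))"
        using q(1) by (simp add: eq in_keys_iff)
      then show ?thesis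
        using 0 by (intro bexI[of _ q]) simp_all
    next
      assume 0: "edge_count ?q = 0"
      have vertex_g: "letters w = [Vertex e]" if "w \<in> Poly_Mapping.keys g" for w
        using count_g[OF that] 0 irred_g[OF that] irred_edge_count_0[of "letters w"] by auto
      have "nf (f * g) = smult (Poly_Mapping.lookup g (Word [Vertex e])) (nf (f * vertex e))"
        by (subst scalar_vertex[OF vertex_g]) (simp_all add: smult_times_right nf_smult)
      then have eq: "nf (f * g) = smult (Poly_Mapping.lookup g (Word [Vertex e])) f"
        by (simp add: nf_times_vertex_id[OF f])
      have "Poly_Mapping.lookup g (Word [Vertex e]) \<noteq> 0"
        using q(1) vertex_g[OF q(1)] by (cases q) (simp add: in_keys_iff)
      then have "p \<in> Poly_Mapping.keys (nf (f * g))"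
        using p(1) by (simp add: eq in_keys_iff)
      then show ?thesis
        using 0 by (intro bexI[of _ p]) simp_all
    qed
  next
    case pos: False
    then have edges: "set ?p \<subseteq> edge_gens H" "set ?q \<subseteq> edge_gens H"
      using irred_edge_count_pos irred_f[OF p(1)] irred_g[OF q(1)] by auto
    obtain u x where u: "?p = u @ [x]"
      using irred_f[OF p(1)] by (cases ?p rule: rev_cases) auto
    obtain y v where v: "?q = y # v"
      using irred_g[OF q(1)] by (cases ?q) auto
    have count: "edge_count ?p = Suc (length u)" "edge_count ?q = Suc (length v)"
      using edges by (simp_all add: edge_count_edges u v del: edge_count_simps)
    have "Poly_Mapping.lookup f (Word (u @ [x])) \<noteq> 0" "Poly_Mapping.lookup g (Word (y # v)) \<noteq> 0"
      using p(1) q(1) unfolding u[symmetric] v[symmetric] by (simp_all add: in_keys_iff)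
    then obtain x' y' where xy: "x' \<in> edge_gens H" "y' \<in> edge_gens H"
      "Poly_Mapping.lookup (nf (f * g)) (Word (u @ x' # y' # v)) \<noteq> 0"
      using ex_top_coefficient[OF f _ g, of u v x y] count_f count_g count edges two
      unfolding u v by metis
    moreover have "edge_count (u @ x' # y' # v) = Suc (length u) + Suc (length v)"
      using edges xy(1,2) by (subst edge_count_edges) (auto simp: u v)
    ultimately show ?thesis
      unfolding count by (intro bexI[of _ "Word (u @ x' # y' # v)"]) (simp_all add: in_keys_iff)
  qed
  then obtain w where w: "w \<in> Poly_Mapping.keys (nf (f * g))"
    "edge_count (letters w) = edge_count ?p + edge_count ?q"
    by blast
  have bound: "nf (f * g) \<in> keys_in {w. edge_count w \<le> edge_count ?p + edge_count ?q}"
    using irred_f irred_g count_f count_g by (intro nf_times_edge_count) (simp_all add: keys_in_def)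
  have path_length_nf: "path_length (letters w) = edge_count (letters w)"
    if "w \<in> Poly_Mapping.keys (nf (f * g))" for w
    using nf_normal_times that by (simp add: keys_in_def path_length_eq)
  have "word_degree (nf (f * g)) = Fin (edge_count ?p + edge_count ?q)"
    using w bound path_length_nf by (intro word_degree_eq_FinI[of _ _ w]) (simp_all add: keys_in_def)
  then show ?thesis
    using irred_f[OF p(1)] irred_g[OF q(1)] by (simp add: p(2) q(2) path_length_eq)
qed

section \<open>The valuation axioms\<close>

lemma local_valuation_LPA:
  assumes "\<forall>h\<in>hedges H. 2 \<le> size (src H h) \<and> 2 \<le> size (rng H h)"
  shows "local_valuation LPA (vertex_elements H S R) (path_valuation H S R)"
proof -
  interpret ring_with_enough_idempotents LPA "vertex_elements H S R"
    by (rule ring_with_enough_idempotents_LPA)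
  have val: "path_valuation H S R (cls f) = word_degree f" if "f \<in> normal" for f
    using that normal_subset_A path_valuation_cls nf_normal by auto
  have two: "2 \<le> length (ends b h)" if "h \<in> hedges H" for h b
    using assms that size_src size_rng by (cases b) auto
  show ?thesis
  proof
    show "path_valuation H S R \<in> carrier LPA \<rightarrow> insert Minf (range Fin)"
      by (simp add: path_valuation_def)
    show "path_valuation H S R x = Minf \<longleftrightarrow> x = \<zero>\<^bsub>LPA\<^esub>" if x: "x \<in> carrier LPA" for x
    proof -
      obtain f where f: "f \<in> normal" "x = cls f"
        using x by (rule LPA_cases)
      then show ?thesis
        using cls_eq_iff_nf[of f 0] normal_subset_A
        by (auto simp: val word_degree_zero_iff zero_LPA nf_normal)
    qed
    show "path_valuation H S R (x \<ominus>\<^bsub>LPA\<^esub> y) \<le> max (path_valuation H S R x) (path_valuation H S R y)"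
      if x: "x \<in> carrier LPA" and y: "y \<in> carrier LPA" for x y
    proof -
      obtain f where f: "f \<in> normal" "x = cls f"
        using x by (rule LPA_cases)
      obtain g where g: "g \<in> normal" "y = cls g"
        using y by (rule LPA_cases)
      have "x \<ominus>\<^bsub>LPA\<^esub> y = cls (f - g)"
        unfolding f g using f(1) g(1) normal_subset_A by (intro minus_LPA) blast+
      then show ?thesis
        using f g by (simp add: val pm.subspace_diff[OF subspace_keys_in] word_degree_diff)
    qed
    fix e x y
    assume e: "e \<in> vertex_elements H S R" and x: "x \<in> (\<lambda>a. a \<otimes>\<^bsub>LPA\<^esub> e) ` carrier LPA"
      and y: "y \<in> (\<lambda>a. e \<otimes>\<^bsub>LPA\<^esub> a) ` carrier LPA"
    obtain v where v: "v \<in> verts H" "e = cls (vertex v)"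
      using e by (auto simp: vertex_elements_eq)
    obtain a where a: "a \<in> carrier LPA" "x = a \<otimes>\<^bsub>LPA\<^esub> e"
      using x by blast
    obtain c where c: "c \<in> carrier LPA" "y = e \<otimes>\<^bsub>LPA\<^esub> c"
      using y by blast
    obtain f where f: "f \<in> normal" "a = cls f"
      using a(1) by (rule LPA_cases)
    obtain g where g: "g \<in> normal" "c = cls g"
      using c(1) by (rule LPA_cases)
    have in_A: "f \<in> A" "g \<in> A" "vertex v \<in> A"
      using f g v vertex_in_A normal_subset_A by auto
    \<comment> \<open>With these representatives, membership of \<open>x\<close> in $Re$ and of
      \<open>y\<close> in $eR$ becomes a condition on the last and first letters of normal forms, so
      all paths involved compose.\<close>
    let ?f = "nf (f * vertex v)" and ?g = "nf (vertex v * g)"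
    have fg: "?f \<in> ends_at v" "?g \<in> starts_at v"
      using f g v nf_times_vertex_ends_at nf_vertex_times_starts_at by auto
    then have normal: "?f \<in> normal" "?g \<in> normal"
      by (auto elim!: keys_in_mono)
    then have nf_A: "?f \<in> A" "?g \<in> A"
      using normal_subset_A by auto
    have xy: "x = cls ?f" "y = cls ?g"
      by (simp_all add: a(2) c(2) f(2) g(2) v(2) mult_LPA[OF in_A(1,3)] mult_LPA[OF in_A(3,2)]
          cls_nf[OF A_times[OF in_A(1,3)]] cls_nf[OF A_times[OF in_A(3,2)]])
    have "path_valuation H S R (x \<otimes>\<^bsub>LPA\<^esub> y) = word_degree (nf (?f * ?g))"
      unfolding xy mult_LPA[OF nf_A] by (rule path_valuation_cls[OF A_times[OF nf_A]])
    also have "\<dots> = word_degree ?f + word_degree ?g"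
      using fg two by (rule word_degree_nf_times)
    finally show "path_valuation H S R (x \<otimes>\<^bsub>LPA\<^esub> y) = path_valuation H S R x + path_valuation H S R y"
      unfolding xy val[OF normal(1)] val[OF normal(2)] .
  qed
qed

end

theorem theorem41:
  fixes H :: "('v, 'h) hypergraph" and S R :: "'h \<Rightarrow> 'v list"
  assumes "hypergraph H"
    and "listing H S R"
    and "\<forall>h\<in>hedges H. 2 \<le> size (src H h) \<and> 2 \<le> size (rng H h)"
  shows "local_valuation
    (leavitt_path_algebra H S R :: (('v, 'h) gen word \<Rightarrow>\<^sub>0 'k::field) set ring)
    (vertex_elements H S R)
    (path_valuation H S R)"
proof -
  interpret leavitt_algebra H S R "TYPE('k)"
    using assms(1,2) by (simp add: leavitt_algebra_def leavitt_setting_def leavitt_setting_axioms_def)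
  show ?thesis
    using assms(3) by (rule local_valuation_LPA)
qed

end
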